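(* Let $0<T_{\min}\le T_{\max}<\infty$. Consider the timer-dependent impulsive system $$\partial_\tau x(t_k+\tau)=A(\tau)x(t_k+\tau)+B_c(\tau)u_c(t_k+\tau)+E_c(\tau)w_c(t_k+\tau),\ \tau\in(0,T_k],\ k\ge0;$$ $$x(t_k^+)=Jx(t_k)+B_du_d(k)+E_dw_d(k),\ k\ge1;\qquad z_d(k)=C_dx(t_k)+D_du_d(k)+F_dw_d(k),\ k\ge1;$$ $$z_c(t_k+\tau)=C_c(\tau)x(t_k+\tau)+D_c(\tau)u_c(t_k+\tau)+F_c(\tau)w_c(t_k+\tau),\ \tau\in(0,T_k],\ k\ge0;\qquad x(0)=x(0^+)=x_0\in\mathbb{R}^n,$$ with $E_c(\tau),F_c(\tau),E_d,F_d$ nonnegative, and the control law $u_c(t_k+\tau)=K_c(\tau)x(t_k+\tau)$, $\tau\in(0,T_k]$, $u_d(k)=K_dx(t_k)$, where $K_c:[0,T_{\max}]\to\mathbb{R}^{m_c\times n}$ and $K_d\in\mathbb{R}^{m_d\times n}$ is independent of the dwell-time. Assume that there exist a differentiable matrix-valued function $X:[0,T_{\max}]\to\mathbb{D}^n$, $X(0)\succ0$, a matrix-valued function $U_c:[0,T_{\max}]\to\mathbb{R}^{m_c\times n}$, matrices $M\in\mathbb{D}^n_{\succ0}$, $U_d\in\mathbb{R}^{m_d\times n}$ and scalars $\varepsilon,\alpha,\gamma>0$ such that $X(\theta)\le M$, $$\begin{array}{rl} A(\tau)X(\tau)+B_c(\tau)U_c(\tau)+\alpha I_n&\ge0,\\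 JM+B_dU_d&\ge0,\\ C_c(\tau)X(\tau)+D_c(\tau)U_c(\tau)&\ge0,\\ C_dM+D_dU_d&\ge0 \end{array}$$ and $$\begin{array}{rl} [-\dot X(\tau)+A(\tau)X(\tau)+B_c(\tau)U_c(\tau)]\mathbf 1+E_c(\tau)\mathbf 1&\le0,\\ {}[JM+B_dU_d-X(0)+\varepsilon I]\mathbf 1+E_d\mathbf 1&\le0,\\ {}[C_c(\tau)X(\tau)+D_c(\tau)U_c(\tau)]\mathbf 1+F_c(\tau)\mathbf 1-\gamma\mathbf 1&\le0,\\ {}[C_dM+D_dU_d]\mathbf 1+F_d\mathbf 1-\gamma\mathbf 1&\le0 \end{array}$$ hold for all $\tau\in[0,T_{\max}]$ and all $\theta\in[T_{\min},T_{\max}]$. Then, under range dwell-time $[T_{\min},T_{\max}]$, the closed-loop system is asymptotically stable and has hybrid $L_\infty\times\ell_\infty$-gain less than $\gamma$ with the controller gains $K_c(\tau)=U_c(\tau)X(\tau)^{-1}$ and $K_d=U_dM^{-1}$.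
   Context: Matrix and vector inequalities $\ge,\le$ are componentwise; $\mathbf 1$ is the all-ones vector; $f(t^+)=\lim_{s\downarrow t}f(s)$; $\mathbb{D}^n$ (resp. $\mathbb{D}^n_{\succ0}$) is the set of $n\times n$ diagonal (resp. diagonal positive definite) matrices and $\succ0$ means positive definite. The functions of the timer $\tau$ (time since the last impulse) are continuous and bounded; $T_k=t_{k+1}-t_k$. Range dwell-time $[T_{\min},T_{\max}]$: all impulse sequences with $t_0=0$ and $t_{k+1}-t_k\in[T_{\min},T_{\max}]$, $k\ge0$, are considered. Stability refers to $w_c,w_d\equiv0$. The hybrid $L_\infty\times\ell_\infty$-gain is the supremum of $\max\{\|z_c\|_{L_\infty},\|z_d\|_{\ell_\infty}\}$ over inputs with $\max\{\|w_c\|_{L_\infty},\|w_d\|_{\ell_\infty}\}=1$, $x_0=0$, and over all these sequences (vector $\infty$-norm pointwise).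
   Formalization: The conclusion is proved as "gain at most γ" instead of "less than γ": the output inequalities are non-strict, and with n=1, A=-1, X=M=1, J=0, B, C, D, E zero, U_c=U_d=0, F_c=γ, F_d=0, ε=α=1 the gain equals γ. *)

theory Defs
  imports "HOL-Analysis.Analysis" "HOL-Probability.Essential_Supremum"
begin

definition diagonal_matrix :: "real^'n^'n \<Rightarrow> bool" where
  "diagonal_matrix D \<longleftrightarrow> (\<forall>i j. i \<noteq> j \<longrightarrow> D $ i $ j = 0)"

definition positive_definite :: "real^'n^'n \<Rightarrow> bool" where
  "positive_definite P \<longleftrightarrow> transpose P = P \<and> (\<forall>v. v \<noteq> 0 \<longrightarrow> v \<bullet> (P *v v) > 0)"

text \<open>
  The data of a timer-dependent impulsive system with state space \<open>real^'n\<close>, control inputs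
  \<open>real^'mc\<close>, \<open>real^'md\<close>, exogenous inputs \<open>real^'pc\<close>, \<open>real^'pd\<close> and outputs \<open>real^'qc\<close>,
  \<open>real^'qd\<close> (continuous-time and discrete-time, respectively).  The matrix functions take the
  timer value as argument.
\<close>

record ('n, 'mc, 'md, 'pc, 'pd, 'qc, 'qd) impulsive_system =
  A_c :: "real \<Rightarrow> real^'n^'n"
  B_c :: "real \<Rightarrow> real^'mc^'n"
  E_c :: "real \<Rightarrow> real^'pc^'n"
  C_c :: "real \<Rightarrow> real^'n^'qc"
  D_c :: "real \<Rightarrow> real^'mc^'qc"
  F_c :: "real \<Rightarrow> real^'pc^'qc"
  J_d :: "real^'n^'n"
  B_d :: "real^'md^'n"
  E_d :: "real^'pd^'n"
  C_d :: "real^'n^'qd"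
  D_d :: "real^'md^'qd"
  F_d :: "real^'pd^'qd"

definition range_dwell_time :: "real \<Rightarrow> real \<Rightarrow> (nat \<Rightarrow> real) \<Rightarrow> bool" where
  "range_dwell_time Tmin Tmax t \<longleftrightarrow>
     t 0 = 0 \<and> (\<forall>k. t (Suc k) - t k \<in> {Tmin..Tmax})"

text \<open>
  The value \<open>x (t k)\<close> is the state just before the impulse at \<open>t k\<close>, for \<open>k \<ge> 1\<close>; the state
  just after it is the right limit of \<open>x\<close> at \<open>t k\<close>.  As the exogenous input \<open>wc\<close> is only
  measurable, the differential equation is understood in the sense of Caratheodory, i.e. as the
  equivalent integral equation.  The values \<open>uc 0\<close>, \<open>zc 0\<close>, \<open>ud 0\<close>, \<open>wd 0\<close>, \<open>zd 0\<close> play no role.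
\<close>

definition is_trajectory ::
  "('n::finite, 'mc::finite, 'md::finite, 'pc::finite, 'pd::finite, 'qc::finite, 'qd::finite)
     impulsive_system \<Rightarrow> (nat \<Rightarrow> real) \<Rightarrow>
   (real \<Rightarrow> real^'mc) \<Rightarrow> (nat \<Rightarrow> real^'md) \<Rightarrow> (real \<Rightarrow> real^'pc) \<Rightarrow> (nat \<Rightarrow> real^'pd) \<Rightarrow>
   (real \<Rightarrow> real^'n) \<Rightarrow> (real \<Rightarrow> real^'qc) \<Rightarrow> (nat \<Rightarrow> real^'qd) \<Rightarrow> bool" where
  "is_trajectory S t uc ud wc wd x zc zd \<longleftrightarrow>
     (x \<longlongrightarrow> x 0) (at_right 0) \<and>
     (\<forall>k. \<forall>\<tau>\<in>{0<..t (Suc k) - t k}.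
        ((\<lambda>s. A_c S s *v x (t k + s) + B_c S s *v uc (t k + s) + E_c S s *v wc (t k + s))
           has_integral (x (t k + \<tau>) - Lim (at_right (t k)) x)) {0..\<tau>}) \<and>
     (\<forall>k\<ge>1. (x \<longlongrightarrow> J_d S *v x (t k) + B_d S *v ud k + E_d S *v wd k) (at_right (t k))) \<and>
     (\<forall>k. \<forall>\<tau>\<in>{0<..t (Suc k) - t k}.
        zc (t k + \<tau>) =
          C_c S \<tau> *v x (t k + \<tau>) + D_c S \<tau> *v uc (t k + \<tau>) + F_c S \<tau> *v wc (t k + \<tau>)) \<and>
     (\<forall>k\<ge>1. zd k = C_d S *v x (t k) + D_d S *v ud k + F_d S *v wd k)"

definition state_feedback ::
  "(real \<Rightarrow> real^'n^'mc) \<Rightarrow> real^'n^'md \<Rightarrow> (nat \<Rightarrow> real) \<Rightarrow>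
   (real \<Rightarrow> real^'mc) \<Rightarrow> (nat \<Rightarrow> real^'md) \<Rightarrow> (real \<Rightarrow> real^'n) \<Rightarrow> bool" where
  "state_feedback Kc Kd t uc ud x \<longleftrightarrow>
     (\<forall>k. \<forall>\<tau>\<in>{0<..t (Suc k) - t k}. uc (t k + \<tau>) = Kc \<tau> *v x (t k + \<tau>)) \<and>
     (\<forall>k\<ge>1. ud k = Kd *v x (t k))"

definition closed_loop_trajectory ::
  "('n::finite, 'mc::finite, 'md::finite, 'pc::finite, 'pd::finite, 'qc::finite, 'qd::finite)
     impulsive_system \<Rightarrow> (real \<Rightarrow> real^'n^'mc) \<Rightarrow> real^'n^'md \<Rightarrow> (nat \<Rightarrow> real) \<Rightarrow>
   (real \<Rightarrow> real^'pc) \<Rightarrow> (nat \<Rightarrow> real^'pd) \<Rightarrow>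
   (real \<Rightarrow> real^'n) \<Rightarrow> (real \<Rightarrow> real^'qc) \<Rightarrow> (nat \<Rightarrow> real^'qd) \<Rightarrow> bool" where
  "closed_loop_trajectory S Kc Kd t wc wd x zc zd \<longleftrightarrow>
     (\<exists>uc ud. state_feedback Kc Kd t uc ud x \<and> is_trajectory S t uc ud wc wd x zc zd)"

text \<open>
  Lyapunov stability and attractivity of the origin for the input-free closed-loop system, for
  all impulse sequences in the class; in the stability part \<open>d\<close> does not depend on the sequence.
\<close>

definition asymptotically_stable ::
  "('n::finite, 'mc::finite, 'md::finite, 'pc::finite, 'pd::finite, 'qc::finite, 'qd::finite)
     impulsive_system \<Rightarrow> (real \<Rightarrow> real^'n^'mc) \<Rightarrow> real^'n^'md \<Rightarrow> real \<Rightarrow> real \<Rightarrow> bool" where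
  "asymptotically_stable S Kc Kd Tmin Tmax \<longleftrightarrow>
     (\<forall>e>0. \<exists>d>0. \<forall>t x zc zd.
        range_dwell_time Tmin Tmax t \<and>
        closed_loop_trajectory S Kc Kd t (\<lambda>_. 0) (\<lambda>_. 0) x zc zd \<and> norm (x 0) < d
        \<longrightarrow> (\<forall>s\<ge>0. norm (x s) < e)) \<and>
     (\<forall>t x zc zd.
        range_dwell_time Tmin Tmax t \<and>
        closed_loop_trajectory S Kc Kd t (\<lambda>_. 0) (\<lambda>_. 0) x zc zd
        \<longrightarrow> (x \<longlongrightarrow> 0) at_top)"

definition L_infinity_norm :: "(real \<Rightarrow> real^'p) \<Rightarrow> ereal" where
  "L_infinity_norm f = esssup (lebesgue_on {0..}) (\<lambda>s. ereal (infnorm (f s)))"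

text \<open>Discrete-time signals are indexed by the impulses \<open>k \<ge> 1\<close>.\<close>

definition l_infinity_norm :: "(nat \<Rightarrow> real^'p) \<Rightarrow> ereal" where
  "l_infinity_norm f = (SUP k\<in>{1..}. ereal (infnorm (f k)))"

definition hybrid_gain ::
  "('n::finite, 'mc::finite, 'md::finite, 'pc::finite, 'pd::finite, 'qc::finite, 'qd::finite)
     impulsive_system \<Rightarrow> (real \<Rightarrow> real^'n^'mc) \<Rightarrow> real^'n^'md \<Rightarrow> real \<Rightarrow> real \<Rightarrow> ereal" where
  "hybrid_gain S Kc Kd Tmin Tmax =
     Sup {max (L_infinity_norm zc) (l_infinity_norm zd) | t wc wd x zc zd.
            range_dwell_time Tmin Tmax t \<and>
            wc \<in> borel_measurable (lebesgue_on {0..}) \<and>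
            max (L_infinity_norm wc) (l_infinity_norm wd) = 1 \<and>
            closed_loop_trajectory S Kc Kd t wc wd x zc zd \<and> x 0 = 0}"

end

theory Submission
  imports Defs
begin

text \<open>
  The proof compares every closed-loop trajectory with the vector function
  \<open>\<xi> \<tau> = X \<tau> *v 1\<close> of the timer.  Multiplied from the right by \<open>X \<tau>\<close>, the closed-loop matrix
  \<open>A + B K\<close> becomes \<open>A X + B U\<close>; since \<open>X \<tau>\<close> is diagonal with positive diagonal, the sign
  conditions on this and the analogous products say that the closed-loop flow matrix has nonnegative off-diagonal
  entries and that the other closed-loop matrices are nonnegative.  The closed loop is thus a
  positive system, and the row sum conditions say that \<open>\<xi>\<close> is a supersolution of its flow under
  the constant input \<open>1\<close>.

  Hence \<open>\<bar>x\<bar> \<le> c *\<^sub>R \<xi> 0\<close> just after an impulse implies \<open>\<bar>x\<bar> \<le> c *\<^sub>R \<xi> \<tau>\<close> at all timer values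
  \<open>\<tau>\<close> before the next one, as long as the inputs are bounded by \<open>c\<close>.  The next impulse finds the
  state below \<open>c *\<^sub>R (M *v 1)\<close>, because \<open>X \<theta> \<le> M\<close> at all admissible dwell times \<open>\<theta>\<close>, and sends it
  below \<open>c *\<^sub>R (\<xi> 0 - \<epsilon> *\<^sub>R 1)\<close>.  With \<open>c = 1\<close> this makes \<open>\<bar>x\<bar> \<le> \<xi>\<close> invariant, and the output
  inequalities turn it into the bound \<open>\<gamma>\<close> on both outputs.  Without inputs, the margin \<open>\<epsilon>\<close>
  shrinks the constant \<open>c\<close> by a fixed factor \<open>\<rho> < 1\<close> at every impulse, which gives stability and
  attractivity.

  Two points need care.  The matrix \<open>X \<tau>\<close> is assumed positive only at \<open>\<tau> = 0\<close>; that it stays so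
  (\<open>diagonal_certificate_pos\<close>) follows from the boundedness of the closed-loop matrix, and is
  proved by the same argument (\<open>orthant_invariant\<close>) as the comparison of flows
  (\<open>flow_upper_bound\<close>).  And the essential supremum of a non-measurable function is infinite, so
  the bound on the continuous-time output includes its measurability (\<open>output_measurable\<close>).
\<close>

section \<open>Nonnegative and diagonal matrices\<close>

lemma matrix_vector_mult_uminus:
  fixes P :: "real^'a::finite^'b::finite"
  shows "P *v (- u) = - (P *v u)"
  by (simp add: matrix_vector_mult_def vec_eq_iff sum_negf)

lemma matrix_vector_mult_mono:
  fixes P :: "real^'a::finite^'b::finite"
  assumes "0 \<le> P" "u \<le> v"
  shows "P *v u \<le> P *v v"
  using assms by (auto simp: less_eq_vec_def matrix_vector_mult_def intro!: sum_mono mult_left_mono)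

lemma abs_matrix_vector_mult_le:
  fixes P :: "real^'a::finite^'b::finite"
  assumes "0 \<le> P" "\<bar>u\<bar> \<le> v"
  shows "\<bar>P *v u\<bar> \<le> P *v v"
proof -
  have "u \<le> v" "- u \<le> v"
    using assms(2) by (simp_all add: abs_le_iff)
  then have "P *v u \<le> P *v v" "P *v (- u) \<le> P *v v"
    using assms(1) by (auto intro: matrix_vector_mult_mono)
  then show ?thesis
    by (simp add: abs_le_iff matrix_vector_mult_uminus)
qed

lemma abs_output_le:
  fixes Cz :: "real^'a::finite^'q::finite" and Fz :: "real^'b::finite^'q"
  assumes "0 \<le> Cz" "0 \<le> Fz" "\<bar>u\<bar> \<le> b" "\<bar>w\<bar> \<le> 1" "Cz *v b + Fz *v 1 \<le> g"
  shows "\<bar>Cz *v u + Fz *v w\<bar> \<le> g"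
proof -
  have "\<bar>Cz *v u + Fz *v w\<bar> \<le> \<bar>Cz *v u\<bar> + \<bar>Fz *v w\<bar>"
    by (rule abs_triangle_ineq)
  also have "\<dots> \<le> Cz *v b + Fz *v 1"
    by (intro add_mono abs_matrix_vector_mult_le assms)
  finally show ?thesis using assms(5) by (rule order_trans)
qed

lemma matrix_entries_bounded:
  fixes A :: "real \<Rightarrow> real^'a::finite^'b::finite"
  assumes "continuous_on {a..b} A"
  obtains L where "0 < L" "\<And>\<tau> i j. \<tau> \<in> {a..b} \<Longrightarrow> \<bar>A \<tau> $ i $ j\<bar> \<le> L"
proof -
  have "compact (A ` {a..b})"
    by (intro compact_continuous_image assms compact_Icc)
  then obtain L where L: "0 < L" "\<forall>P \<in> A ` {a..b}. norm P \<le> L"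
    using compact_imp_bounded bounded_pos by blast
  have "\<bar>A \<tau> $ i $ j\<bar> \<le> L" if "\<tau> \<in> {a..b}" for \<tau> i j
  proof -
    have "\<bar>A \<tau> $ i $ j\<bar> \<le> norm (A \<tau> $ i)"
      by (rule component_le_norm_cart)
    also have "\<dots> \<le> norm (A \<tau>)"
      by (rule Finite_Cartesian_Product.norm_nth_le)
    finally show ?thesis using L that by force
  qed
  with L(1) show ?thesis by (rule that)
qed

lemma has_vector_derivative_matrix_vector_mult:
  fixes P :: "real \<Rightarrow> real^'a::finite^'b::finite"
  assumes "(P has_vector_derivative P') F"
  shows "((\<lambda>\<tau>. P \<tau> *v u) has_vector_derivative P' *v u) F"
proof -
  have "linear (\<lambda>Q :: real^'a^'b. Q *v u)"
    by (intro linearI) (simp_all add: matrix_vector_mult_add_rdistrib scaleR_matrix_vector_assoc)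
  then have "bounded_linear (\<lambda>Q :: real^'a^'b. Q *v u)"
    by (rule linear_conv_bounded_linear[THEN iffD1])
  then show ?thesis
    using assms by (rule bounded_linear.has_vector_derivative)
qed

lemma borel_measurable_matrix_vector_mult:
  fixes P :: "'s \<Rightarrow> real^'a::finite^'b::finite"
  assumes "P \<in> borel_measurable M" "u \<in> borel_measurable M"
  shows "(\<lambda>s. P s *v u s) \<in> borel_measurable M"
  using assms
proof (rule borel_measurable_continuous_Pair)
  show "continuous_on UNIV (\<lambda>p :: (real^'a^'b) \<times> (real^'a). fst p *v snd p)"
    unfolding matrix_vector_mult_def by (intro continuous_intros)
qed

lemma continuous_on_matrix_mult:
  fixes P :: "'s::topological_space \<Rightarrow> real^'a::finite^'b::finite" and Q :: "'s \<Rightarrow> real^'c::finite^'a"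
  assumes "continuous_on D P" "continuous_on D Q"
  shows "continuous_on D (\<lambda>s. P s ** Q s)"
  unfolding matrix_matrix_mult_def by (intro continuous_intros assms)

lemma diagonal_matrix_mult_nth:
  fixes P :: "real^'a::finite^'b::finite"
  assumes "diagonal_matrix D"
  shows "(P ** D) $ i $ j = P $ i $ j * D $ j $ j"
proof -
  have "(P ** D) $ i $ j = (\<Sum>k\<in>UNIV. P $ i $ k * D $ k $ j)"
    by (simp add: matrix_matrix_mult_def)
  also have "\<dots> = (\<Sum>k\<in>{j}. P $ i $ k * D $ k $ j)"
    using assms by (intro sum.mono_neutral_right) (auto simp: diagonal_matrix_def)
  finally show ?thesis by simp
qed

lemma diagonal_matrix_mult_one_nth:
  fixes D :: "real^'a::finite^'a"
  assumes "diagonal_matrix D"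
  shows "(D *v 1) $ i = D $ i $ i"
proof -
  have "(D *v 1) $ i = (\<Sum>k\<in>UNIV. D $ i $ k)"
    by (simp add: matrix_vector_mult_def)
  also have "\<dots> = (\<Sum>k\<in>{i}. D $ i $ k)"
    using assms by (intro sum.mono_neutral_right) (auto simp: diagonal_matrix_def)
  finally show ?thesis by simp
qed

lemma positive_definite_diagonal_pos:
  fixes P :: "real^'a::finite^'a"
  assumes "positive_definite P"
  shows "0 < P $ i $ i"
proof -
  have "axis i 1 \<bullet> (P *v axis i 1) > 0"
    using assms by (simp add: positive_definite_def axis_eq_0_iff)
  then show ?thesis
    by (simp add: matrix_vector_mult_basis column_def inner_axis')
qed

lemma positive_diagonal_matrix_inv:
  fixes D :: "real^'a::finite^'a"
  assumes D: "diagonal_matrix D" "\<And>i. 0 < D $ i $ i"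
  shows "matrix_inv D ** D = mat 1"
proof -
  define R :: "real^'a^'a" where "R = (\<chi> i j. if i = j then 1 / D $ i $ i else 0)"
  have "R ** D = mat 1"
    using D by (auto simp: vec_eq_iff diagonal_matrix_mult_nth R_def mat_def less_imp_neq[symmetric])
  then have "D ** R = mat 1 \<and> R ** D = mat 1"
    using matrix_left_right_inverse by blast
  then have "D ** matrix_inv D = mat 1 \<and> matrix_inv D ** D = mat 1"
    unfolding matrix_inv_def by (rule someI)
  then show ?thesis by simp
qed

text \<open>
  The change of variables behind the design: the conditions are stated for \<open>U = G D\<close>, in which
  they are linear, and this returns to the closed-loop matrix with gain \<open>G\<close>.
\<close>
lemma closed_loop_mult:
  fixes P :: "real^'n::finite^'b::finite" and D :: "real^'n^'n"
  assumes "diagonal_matrix D" "\<And>i. 0 < D $ i $ i" "G = U ** matrix_inv D"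
  shows "(P + Q ** G) ** D = P ** D + Q ** U"
proof -
  have "(P + Q ** G) ** D = P ** D + (Q ** G) ** D"
    by (vector matrix_matrix_mult_def sum.distrib distrib_right)
  also have "(Q ** G) ** D = Q ** U ** (matrix_inv D ** D)"
    by (simp only: assms(3) matrix_mul_assoc)
  finally show ?thesis
    using positive_diagonal_matrix_inv[OF assms(1,2)] by simp
qed

lemma nonneg_of_mult_diagonal:
  fixes P :: "real^'n::finite^'b::finite"
  assumes D: "diagonal_matrix D" "\<And>i. 0 < D $ i $ i" and nonneg: "0 \<le> P ** D"
  shows "0 \<le> P"
proof -
  have "0 \<le> P $ i $ j * D $ j $ j" for i j
    using nonneg by (simp add: less_eq_vec_def diagonal_matrix_mult_nth[OF D(1), symmetric])
  then show ?thesis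
    using D(2) by (simp add: less_eq_vec_def zero_le_mult_iff) (meson not_less)
qed

section \<open>Uniform bounds on signals\<close>

text \<open>
  Translates norm bounds on inputs and outputs into the componentwise order, in which the
  comparison takes place.
\<close>
lemma infnorm_le_iff:
  fixes u :: "real^'p::finite"
  shows "infnorm u \<le> c \<longleftrightarrow> \<bar>u\<bar> \<le> c *\<^sub>R 1"
proof -
  have "infnorm u \<le> c \<longleftrightarrow> (\<forall>i. \<bar>u $ i\<bar> \<le> c)"
  proof
    show "\<forall>i. \<bar>u $ i\<bar> \<le> c" if "infnorm u \<le> c"
      using that component_le_infnorm_cart order_trans by blast
    show "infnorm u \<le> c" if "\<forall>i. \<bar>u $ i\<bar> \<le> c"
      unfolding infnorm_cart by (rule cSup_least) (use that in auto)
  qed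
  then show ?thesis by (simp add: less_eq_vec_def abs_vec_def)
qed

lemma AE_lebesgue_on_iff:
  assumes "S \<in> sets lebesgue"
  shows "(AE s in lebesgue_on S. P s) \<longleftrightarrow> (\<exists>N. negligible N \<and> (\<forall>s\<in>S - N. P s))"
proof -
  have "(AE s in lebesgue_on S. P s) \<longleftrightarrow> (AE s in lebesgue. s \<in> S \<longrightarrow> P s)"
    using assms by (intro AE_restrict_space_iff) simp
  also have "\<dots> \<longleftrightarrow> (\<exists>N. negligible N \<and> (\<forall>s\<in>S - N. P s))"
    unfolding eventually_ae_filter by (auto simp: negligible_iff_null_sets)
  finally show ?thesis .
qed

lemma L_infinity_norm_le_imp:
  assumes "L_infinity_norm w \<le> ereal c"
  obtains N where "negligible N" "\<And>s. 0 \<le> s \<Longrightarrow> s \<notin> N \<Longrightarrow> \<bar>w s\<bar> \<le> c *\<^sub>R 1"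
proof -
  have "AE s in lebesgue_on {0..}. ereal (infnorm (w s)) \<le> L_infinity_norm w"
    unfolding L_infinity_norm_def by (rule esssup_AE)
  then have "AE s in lebesgue_on {0..}. \<bar>w s\<bar> \<le> c *\<^sub>R 1"
    using assms by (auto elim!: eventually_mono simp: infnorm_le_iff[symmetric] dest: order_trans)
  then show ?thesis
    using that by (auto simp: AE_lebesgue_on_iff)
qed

lemma L_infinity_norm_leI:
  assumes meas: "z \<in> borel_measurable (lebesgue_on {0..})"
    and N: "negligible N" and le: "\<And>s. 0 \<le> s \<Longrightarrow> s \<notin> N \<Longrightarrow> \<bar>z s\<bar> \<le> c *\<^sub>R 1"
  shows "L_infinity_norm z \<le> ereal c"
  unfolding L_infinity_norm_def
proof (rule esssup_I)
  have "(\<lambda>s. infnorm (z s)) \<in> borel_measurable (lebesgue_on {0..})"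
    by (rule measurable_compose[OF meas]) (intro borel_measurable_continuous_onI continuous_intros)
  then show "(\<lambda>s. ereal (infnorm (z s))) \<in> borel_measurable (lebesgue_on {0..})"
    by simp
  show "AE s in lebesgue_on {0..}. ereal (infnorm (z s)) \<le> ereal c"
    using N le by (auto simp: AE_lebesgue_on_iff infnorm_le_iff)
qed

lemma l_infinity_norm_le_iff:
  "l_infinity_norm w \<le> ereal c \<longleftrightarrow> (\<forall>k\<ge>1. \<bar>w k\<bar> \<le> c *\<^sub>R 1)"
  unfolding l_infinity_norm_def by (simp add: SUP_le_iff infnorm_le_iff Ball_def)

section \<open>Invariance of the positive orthant\<close>

text \<open>
  A trajectory can reach the boundary of the open positive orthant only if one of its components
  decays to zero in finite time, and a decay rate of at most \<open>L\<close> excludes this.  The decay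
  condition is in integral form, so that it also covers trajectories that are not differentiable
  everywhere, and is demanded only up to times before which all components are positive: this
  is where the sign of the coupling terms is known.
\<close>
lemma orthant_invariant:
  fixes e :: "real \<Rightarrow> real^'n::finite"
  assumes cont: "continuous_on {0..T} e"
    and init: "\<And>i. 0 < e 0 $ i"
    and L: "0 < L"
    and decay: "\<And>s \<tau> i. 0 \<le> s \<Longrightarrow> s \<le> \<tau> \<Longrightarrow> \<tau> \<le> T \<Longrightarrow> (\<And>r j. r \<in> {s..<\<tau>} \<Longrightarrow> 0 < e r $ j) \<Longrightarrow>
        e s $ i - L * integral {s..\<tau>} (\<lambda>r. e r $ i) \<le> e \<tau> $ i"
    and \<tau>: "\<tau> \<in> {0..T}"
  shows "0 < e \<tau> $ i"
proof (rule ccontr)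
  assume neg: "\<not> 0 < e \<tau> $ i"
  define Z where "Z = (\<Union>j. {r\<in>{0..T}. e r $ j \<le> 0})"
  have cont_nth: "continuous_on {0..T} (\<lambda>r. e r $ j)" for j
    by (intro continuous_intros cont)
  have "closed {r\<in>{0..T}. e r $ j \<le> 0}" for j
    by (intro continuous_on_closed_Collect_le cont_nth continuous_on_const closed_atLeastAtMost)
  then have "closed Z"
    unfolding Z_def by (intro closed_UN) auto
  moreover have "Z \<noteq> {}" "bdd_below Z"
    using neg \<tau> unfolding Z_def by (auto simp: not_less intro!: bdd_belowI[of _ 0])
  ultimately have "Inf Z \<in> Z"
    by (intro closed_contains_Inf)
  define \<sigma> where "\<sigma> = Inf Z"
  obtain k where k: "\<sigma> \<in> {0..T}" "e \<sigma> $ k \<le> 0"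
    using \<open>Inf Z \<in> Z\<close> unfolding Z_def \<sigma>_def by auto
  have before: "0 < e r $ j" if "0 \<le> r" "r < \<sigma>" for r j
  proof (rule ccontr)
    assume "\<not> ?thesis"
    with that k have "r \<in> Z"
      unfolding Z_def by (auto simp: not_less)
    then have "\<sigma> \<le> r"
      unfolding \<sigma>_def using \<open>bdd_below Z\<close> by (rule cInf_lower)
    with that show False by simp
  qed
  have "\<sigma> \<noteq> 0"
    using init[of k] k by auto
  then have "0 < \<sigma>"
    using k by auto
  \<comment> \<open>On an interval ending at the first exit time \<open>\<sigma>\<close> and of length at most \<open>1 / (2 * L)\<close>, the
    component that vanishes at \<open>\<sigma>\<close> loses at most half of its maximum, starting from where the
    maximum is attained.\<close>
  define s where "s = max 0 (\<sigma> - 1 / (2 * L))"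
  have s: "0 \<le> s" "s < \<sigma>" "\<sigma> - s \<le> 1 / (2 * L)"
    using \<open>0 < \<sigma>\<close> L unfolding s_def by auto
  have "continuous_on {s..\<sigma>} (\<lambda>r. e r $ k)"
    by (rule continuous_on_subset[OF cont_nth]) (use s k in auto)
  then obtain p where p: "p \<in> {s..\<sigma>}" and p_max: "\<And>r. r \<in> {s..\<sigma>} \<Longrightarrow> e r $ k \<le> e p $ k"
    using continuous_attains_sup[of "{s..\<sigma>}" "\<lambda>r. e r $ k"] s by auto
  have "0 < e p $ k"
    using p_max[of s] before[of s k] s by auto
  have "e p $ k - L * integral {p..\<sigma>} (\<lambda>r. e r $ k) \<le> e \<sigma> $ k"
    by (rule decay) (use p s k before in auto)
  moreover have "integral {p..\<sigma>} (\<lambda>r. e r $ k) \<le> integral {p..\<sigma>} (\<lambda>r. e p $ k)"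
    by (rule integral_le)
      (use p s k in \<open>auto intro!: p_max integrable_continuous_interval continuous_on_subset[OF cont_nth]\<close>)
  moreover have "integral {p..\<sigma>} (\<lambda>r. e p $ k) = (\<sigma> - p) * e p $ k"
    using p by simp
  moreover have "(\<sigma> - p) * e p $ k \<le> 1 / (2 * L) * e p $ k"
    using p s \<open>0 < e p $ k\<close> by (intro mult_right_mono) auto
  ultimately have "e p $ k \<le> L * (1 / (2 * L) * e p $ k)"
    using k L by (smt (verit, best) mult_left_mono)
  then show False
    using \<open>0 < e p $ k\<close> L by simp
qed

text \<open>
  Provides the decay condition of \<open>orthant_invariant\<close> from a differential inequality that holds
  almost everywhere.
\<close>
lemma integral_decay:
  fixes y :: "real \<Rightarrow> real"
  assumes h: "(h has_integral (y \<tau> - y s)) {s..\<tau>}"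
    and y: "continuous_on {s..\<tau>} y" and N: "negligible N"
    and le: "\<And>r. r \<in> {s..<\<tau>} - N \<Longrightarrow> - L * y r \<le> h r"
  shows "y s - L * integral {s..\<tau>} y \<le> y \<tau>"
proof -
  \<comment> \<open>Nothing is known about \<open>h\<close> on \<open>N\<close> and at the end point, so \<open>h\<close> is redefined there.\<close>
  have spiked: "((\<lambda>r. if r \<in> insert \<tau> N then - L * y r else h r) has_integral (y \<tau> - y s)) {s..\<tau>}"
    by (rule has_integral_spike[OF _ _ h, of "insert \<tau> N"]) (use N in auto)
  have "((\<lambda>r. - L * y r) has_integral - L * integral {s..\<tau>} y) {s..\<tau>}"
    by (intro has_integral_mult_right integrable_integral integrable_continuous_interval y)
  from this spiked have "- L * integral {s..\<tau>} y \<le> y \<tau> - y s"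
    by (rule has_integral_le) (use le in auto)
  then show ?thesis by simp
qed

text \<open>
  As long as the diagonal of \<open>X \<tau>\<close> is positive, \<open>X \<tau>\<close> is invertible and \<open>A X + B U = (A + B K) X\<close>.
  Since the off-diagonal entries of this matrix are nonnegative, the row sum inequality bounds
  \<open>X' $ i $ i\<close> below by \<open>(A + B K) $ i $ i * X $ i $ i\<close>.  The matrix \<open>A + B K\<close> is continuous, hence
  bounded, so the diagonal decays at most exponentially and cannot reach zero.
\<close>
lemma diagonal_certificate_pos:
  fixes A :: "real \<Rightarrow> real^'n::finite^'n" and B :: "real \<Rightarrow> real^'m::finite^'n"
  assumes X_diagonal: "\<And>\<tau>. \<tau> \<in> {0..T} \<Longrightarrow> diagonal_matrix (X \<tau>)"
    and X_deriv: "\<And>\<tau>. \<tau> \<in> {0..T} \<Longrightarrow> (X has_vector_derivative X' \<tau>) (at \<tau> within {0..T})"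
    and X_0: "\<And>i. 0 < X 0 $ i $ i"
    and A_cont: "continuous_on {0..T} (\<lambda>\<tau>. A \<tau> + B \<tau> ** K \<tau>)"
    and K: "\<And>\<tau>. \<tau> \<in> {0..T} \<Longrightarrow> K \<tau> = U \<tau> ** matrix_inv (X \<tau>)"
    and off: "\<And>\<tau>. \<tau> \<in> {0..T} \<Longrightarrow> 0 \<le> A \<tau> ** X \<tau> + B \<tau> ** U \<tau> + \<alpha> *\<^sub>R mat 1"
    and super: "\<And>\<tau>. \<tau> \<in> {0..T} \<Longrightarrow> (A \<tau> ** X \<tau> + B \<tau> ** U \<tau>) *v 1 \<le> X' \<tau> *v 1"
    and \<tau>: "\<tau> \<in> {0..T}"
  shows "0 < X \<tau> $ i $ i"
proof -
  let ?A = "\<lambda>\<tau>. A \<tau> + B \<tau> ** K \<tau>"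
  obtain L where L: "0 < L" "\<And>\<tau> i j. \<tau> \<in> {0..T} \<Longrightarrow> \<bar>?A \<tau> $ i $ j\<bar> \<le> L"
    using matrix_entries_bounded[OF A_cont] by blast
  have T: "0 \<in> {0..T}" using \<tau> by auto
  have X_nth: "(X \<tau> *v 1) $ i = X \<tau> $ i $ i" if "\<tau> \<in> {0..T}" for \<tau> i
    by (rule diagonal_matrix_mult_one_nth[OF X_diagonal[OF that]])
  have \<xi>_deriv: "((\<lambda>\<tau>. X \<tau> *v 1) has_vector_derivative X' \<tau> *v 1) (at \<tau> within {0..T})"
    if "\<tau> \<in> {0..T}" for \<tau>
    by (rule has_vector_derivative_matrix_vector_mult[OF X_deriv[OF that]])
  have \<xi>_cont: "continuous_on {0..T} (\<lambda>\<tau>. X \<tau> *v 1)"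
    using \<xi>_deriv by (rule continuous_on_vector_derivative)
  have "0 < (X \<tau> *v 1) $ i"
  proof (rule orthant_invariant[where e = "\<lambda>\<tau>. X \<tau> *v 1", OF \<xi>_cont _ L(1) _ \<tau>])
    show "0 < (X 0 *v 1) $ i" for i
      using X_0 X_nth[OF T] by simp
    fix s \<tau> i
    assume s: "0 \<le> s" "s \<le> \<tau>" "\<tau> \<le> T"
      and pos: "\<And>r j. r \<in> {s..<\<tau>} \<Longrightarrow> 0 < (X r *v 1) $ j"
    have sub: "{s..\<tau>} \<subseteq> {0..T}" using s by auto
    have "((\<lambda>r. X' r *v 1) has_integral (X \<tau> *v 1 - X s *v 1)) {s..\<tau>}"
      by (intro fundamental_theorem_of_calculus s
            has_vector_derivative_within_subset[OF \<xi>_deriv sub]) (use sub in auto)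
    then have "((\<lambda>r. (X' r *v 1) $ i) has_integral ((X \<tau> *v 1) $ i - (X s *v 1) $ i)) {s..\<tau>}"
      by (auto dest: has_integral_linear[OF _ bounded_linear_vec_nth] simp: o_def)
    then show "(X s *v 1) $ i - L * integral {s..\<tau>} (\<lambda>r. (X r *v 1) $ i) \<le> (X \<tau> *v 1) $ i"
    proof (rule integral_decay[OF _ _ negligible_empty])
      show "continuous_on {s..\<tau>} (\<lambda>r. (X r *v 1) $ i)"
        by (intro continuous_on_component continuous_on_subset[OF \<xi>_cont sub])
      fix r assume r: "r \<in> {s..<\<tau>} - {}"
      then have rT: "r \<in> {0..T}" using s by auto
      have r_pos: "0 < X r $ j $ j" for j
        using pos[of r j] r X_nth[OF rT] by simp
      let ?Q = "A r ** X r + B r ** U r"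
      have Q: "?Q = ?A r ** X r"
        by (rule closed_loop_mult[OF X_diagonal[OF rT] r_pos K[OF rT], symmetric])
      have "- L * X r $ i $ i \<le> ?A r $ i $ i * X r $ i $ i"
        using L(2)[OF rT, of i i] less_imp_le[OF r_pos[of i]]
        by (intro mult_right_mono) (auto simp: abs_le_iff)
      also have "\<dots> = ?Q $ i $ i"
        by (simp only: Q diagonal_matrix_mult_nth[OF X_diagonal[OF rT]])
      also have "\<dots> = (\<Sum>j\<in>{i}. ?Q $ i $ j)"
        by simp
      also have "\<dots> \<le> (\<Sum>j\<in>UNIV. ?Q $ i $ j)"
      proof (rule sum_mono2)
        fix j assume "j \<in> UNIV - {i}"
        then have "(mat 1 :: real^'n^'n) $ i $ j = 0"
          by (simp add: mat_def)
        moreover have "0 \<le> (?Q + \<alpha> *\<^sub>R mat 1) $ i $ j"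
          using off[OF rT] unfolding less_eq_vec_def by simp
        ultimately show "0 \<le> ?Q $ i $ j" by simp
      qed auto
      also have "\<dots> = (?Q *v 1) $ i"
        by (simp add: matrix_vector_mult_def)
      also have "\<dots> \<le> (X' r *v 1) $ i"
        using super[OF rT] unfolding less_eq_vec_def by blast
      finally show "- L * (X r *v 1) $ i \<le> (X' r *v 1) $ i"
        by (simp add: X_nth[OF rT])
    qed
  qed
  then show ?thesis using X_nth[OF \<tau>] by simp
qed

section \<open>Impulse sequences with range dwell-time\<close>

lemma dwell_time_ge:
  assumes "range_dwell_time Tmin Tmax t"
  shows "of_nat k * Tmin \<le> t k"
proof (induction k)
  case 0
  show ?case using assms by (simp add: range_dwell_time_def)
next
  case (Suc k)
  have "Tmin \<le> t (Suc k) - t k" using assms by (simp add: range_dwell_time_def)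
  with Suc show ?case by (simp add: algebra_simps)
qed

lemma dwell_time_nonneg:
  assumes "range_dwell_time Tmin Tmax t" "0 \<le> Tmin"
  shows "0 \<le> t k"
  using dwell_time_ge[OF assms(1), of k] assms(2) by (meson mult_nonneg_nonneg of_nat_0_le_iff order_trans)

lemma dwell_time_strict_mono:
  assumes "range_dwell_time Tmin Tmax t" "0 < Tmin"
  shows "strict_mono t"
proof (rule strict_monoI_Suc)
  fix k
  have "Tmin \<le> t (Suc k) - t k" using assms by (simp add: range_dwell_time_def)
  with assms show "t k < t (Suc k)" by simp
qed

lemma dwell_time_cover:
  assumes t: "range_dwell_time Tmin Tmax t" "0 < Tmin" and s: "0 < s"
  obtains k \<tau> where "\<tau> \<in> {0<..t (Suc k) - t k}" "s = t k + \<tau>"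
proof -
  obtain n where n: "s < of_nat n * Tmin"
    using reals_Archimedean3[OF \<open>0 < Tmin\<close>] by blast
  then have ex: "\<exists>n. s \<le> t n"
    using dwell_time_ge[OF t(1), of n] by (intro exI[of _ n]) simp
  define m where "m = (LEAST n. s \<le> t n)"
  have m: "s \<le> t m" unfolding m_def by (rule LeastI_ex[OF ex])
  have "m \<noteq> 0"
    using m s t by (auto simp: range_dwell_time_def intro: ccontr)
  then obtain k where k: "m = Suc k" by (cases m) auto
  have "t k < s"
    using not_less_Least[of k "\<lambda>n. s \<le> t n"] unfolding m_def[symmetric] k by simp
  with m k show ?thesis
    by (intro that[of "s - t k" k]) auto
qed

section \<open>Comparison for the flow of a positive impulsive system\<close>

text \<open>
  A positive impulsive system, with the closed-loop matrices \<open>A\<close> and \<open>J\<close> already formed, and a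
  comparison function for it: \<open>\<xi>\<close> is a supersolution of the flow under the input \<open>1\<close>, and the
  impulse map sends its bound \<open>\<mu>\<close> at the possible dwell times back below \<open>\<xi> 0\<close>, with margin
  \<open>\<epsilon>\<close>.
\<close>
locale positive_impulsive =
  fixes A :: "real \<Rightarrow> real^'n::finite^'n" and E :: "real \<Rightarrow> real^'pc::finite^'n"
    and J :: "real^'n^'n" and Ed :: "real^'pd::finite^'n"
    and \<xi> \<xi>' :: "real \<Rightarrow> real^'n" and \<mu> :: "real^'n" and Tmin Tmax \<epsilon> :: real
  assumes dwell: "0 < Tmin" "Tmin \<le> Tmax"
    and A_cont: "continuous_on {0..Tmax} A"
    and Metzler: "\<And>\<tau> i j. \<tau> \<in> {0..Tmax} \<Longrightarrow> i \<noteq> j \<Longrightarrow> 0 \<le> A \<tau> $ i $ j"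
    and E_nonneg: "\<And>\<tau>. \<tau> \<in> {0..Tmax} \<Longrightarrow> 0 \<le> E \<tau>"
    and J_nonneg: "0 \<le> J" and Ed_nonneg: "0 \<le> Ed"
    and \<xi>_deriv: "\<And>\<tau>. \<tau> \<in> {0..Tmax} \<Longrightarrow> (\<xi> has_vector_derivative \<xi>' \<tau>) (at \<tau> within {0..Tmax})"
    and \<xi>_pos: "\<And>\<tau> i. \<tau> \<in> {0..Tmax} \<Longrightarrow> 0 < \<xi> \<tau> $ i"
    and flow_supersolution: "\<And>\<tau>. \<tau> \<in> {0..Tmax} \<Longrightarrow> A \<tau> *v \<xi> \<tau> + E \<tau> *v 1 \<le> \<xi>' \<tau>"
    and \<xi>_le_\<mu>: "\<And>\<theta>. \<theta> \<in> {Tmin..Tmax} \<Longrightarrow> \<xi> \<theta> \<le> \<mu>"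
    and \<epsilon>_pos: "0 < \<epsilon>"
    and jump_supersolution: "J *v \<mu> + Ed *v 1 + \<epsilon> *\<^sub>R 1 \<le> \<xi> 0"
begin

lemma \<xi>_cont: "continuous_on {0..Tmax} \<xi>"
  using \<xi>_deriv by (rule continuous_on_vector_derivative)

text \<open>
  The difference \<open>e = c *\<^sub>R \<xi> - v\<close> satisfies \<open>e' \<ge> A e\<close> almost everywhere.  As \<open>A\<close> has nonnegative
  off-diagonal entries, while \<open>e\<close> is positive each component decays at a rate of at most
  \<open>\<bar>A $ i $ i\<bar>\<close>, so \<open>orthant_invariant\<close> applies.  It needs a strictly positive initial value,
  hence the proof works with \<open>c + \<eta>\<close> in place of \<open>c\<close>; as \<open>\<xi>\<close> itself is a supersolution, this
  preserves the inequality for \<open>e\<close>.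
\<close>
lemma flow_upper_bound:
  assumes T: "T \<le> Tmax"
    and flow: "\<And>\<tau>. \<tau> \<in> {0..T} \<Longrightarrow>
      ((\<lambda>s. A s *v v s + E s *v w s) has_integral (v \<tau> - v 0)) {0..\<tau>}"
    and N: "negligible N" and w: "\<And>s. s \<in> {0..T} - N \<Longrightarrow> w s \<le> c *\<^sub>R 1"
    and c: "0 \<le> c" and init: "v 0 \<le> c *\<^sub>R \<xi> 0"
    and \<tau>: "\<tau> \<in> {0..T}"
  shows "v \<tau> \<le> c *\<^sub>R \<xi> \<tau>"
proof -
  let ?g = "\<lambda>s. A s *v v s + E s *v w s"
  obtain L where L: "0 < L" "\<And>\<tau> i j. \<tau> \<in> {0..Tmax} \<Longrightarrow> \<bar>A \<tau> $ i $ j\<bar> \<le> L"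
    using matrix_entries_bounded[OF A_cont] by blast
  have "0 \<le> T" using \<tau> by auto
  have g_int: "?g integrable_on {0..T}"
    using flow[of T] \<open>0 \<le> T\<close> by (auto simp: integrable_on_def)
  have v_cont: "continuous_on {0..T} v"
  proof (rule continuous_on_eq)
    show "continuous_on {0..T} (\<lambda>\<tau>. v 0 + integral {0..\<tau>} ?g)"
      by (intro continuous_intros indefinite_integral_continuous_1 g_int)
    show "v 0 + integral {0..\<tau>} ?g = v \<tau>" if "\<tau> \<in> {0..T}" for \<tau>
      using integral_unique[OF flow[OF that]] by simp
  qed
  have strict: "0 < ((c + \<eta>) *\<^sub>R \<xi> \<tau> - v \<tau>) $ i" if "0 < \<eta>" for \<eta> i
  proof (rule orthant_invariant[where e = "\<lambda>\<tau>. (c + \<eta>) *\<^sub>R \<xi> \<tau> - v \<tau>" and T = T and L = L])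
    define e where "e = (\<lambda>\<tau>. (c + \<eta>) *\<^sub>R \<xi> \<tau> - v \<tau>)"
    show e_cont: "continuous_on {0..T} (\<lambda>\<tau>. (c + \<eta>) *\<^sub>R \<xi> \<tau> - v \<tau>)"
      by (intro continuous_intros v_cont continuous_on_subset[OF \<xi>_cont]) (use T in auto)
    show "0 < L" by (rule L)
    show "\<tau> \<in> {0..T}" by (rule \<tau>)
    show "0 < ((c + \<eta>) *\<^sub>R \<xi> 0 - v 0) $ i" for i
    proof -
      have "v 0 $ i \<le> c * \<xi> 0 $ i"
        using init by (simp add: less_eq_vec_def)
      moreover have "0 < \<eta> * \<xi> 0 $ i"
        using \<xi>_pos[of 0 i] dwell that by simp
      ultimately show ?thesis
        by (simp add: algebra_simps)
    qed
    fix s \<tau> i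
    assume s: "0 \<le> s" "s \<le> \<tau>" "\<tau> \<le> T"
      and pos: "\<And>r j. r \<in> {s..<\<tau>} \<Longrightarrow> 0 < ((c + \<eta>) *\<^sub>R \<xi> r - v r) $ j"
    have sub: "{s..\<tau>} \<subseteq> {0..Tmax}" "{s..\<tau>} \<subseteq> {0..T}"
      using s T by auto
    have "((\<lambda>r. (c + \<eta>) *\<^sub>R \<xi>' r) has_integral (c + \<eta>) *\<^sub>R (\<xi> \<tau> - \<xi> s)) {s..\<tau>}"
      by (intro has_integral_cmul fundamental_theorem_of_calculus s
            has_vector_derivative_within_subset[OF \<xi>_deriv sub(1)]) (use sub in auto)
    moreover have "(?g has_integral (v \<tau> - v s)) {s..\<tau>}"
    proof -
      have "?g integrable_on {0..\<tau>}"
        using flow[of \<tau>] s by (auto simp: integrable_on_def)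
      moreover from this have "?g integrable_on {s..\<tau>}"
        by (rule integrable_on_subinterval) (use s in auto)
      ultimately show ?thesis
        using Henstock_Kurzweil_Integration.integral_combine[where a = 0 and c = s and b = \<tau> and f = ?g]
          integral_unique[OF flow[of s]] integral_unique[OF flow[of \<tau>]] s
        by (auto simp: has_integral_iff algebra_simps)
    qed
    ultimately have "((\<lambda>r. (c + \<eta>) *\<^sub>R \<xi>' r - ?g r) has_integral (e \<tau> - e s)) {s..\<tau>}"
      by (rule has_integral_eq_rhs[OF has_integral_diff]) (simp add: e_def algebra_simps)
    then have e_int: "((\<lambda>r. ((c + \<eta>) *\<^sub>R \<xi>' r - ?g r) $ i) has_integral (e \<tau> $ i - e s $ i)) {s..\<tau>}"
      by (auto dest: has_integral_linear[OF _ bounded_linear_vec_nth] simp: o_def)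
    have "e s $ i - L * integral {s..\<tau>} (\<lambda>r. e r $ i) \<le> e \<tau> $ i"
    proof (rule integral_decay[OF e_int _ N])
      show "continuous_on {s..\<tau>} (\<lambda>r. e r $ i)"
        unfolding e_def
        by (intro continuous_on_component continuous_on_subset[OF e_cont sub(2)])
      fix r assume r: "r \<in> {s..<\<tau>} - N"
      have rT: "r \<in> {0..Tmax}" "r \<in> {0..T}"
        using r s T by auto
      have e_pos: "0 < e r $ j" for j
        unfolding e_def using pos[of r j] r by auto
      have "- L * e r $ i \<le> A r $ i $ i * e r $ i"
        using L(2)[OF rT(1), of i i] e_pos[of i] by (intro mult_right_mono) (auto simp: abs_le_iff)
      also have "\<dots> \<le> (\<Sum>j\<in>UNIV. A r $ i $ j * e r $ j)"
      proof -
        have "(\<Sum>j\<in>{i}. A r $ i $ j * e r $ j) \<le> (\<Sum>j\<in>UNIV. A r $ i $ j * e r $ j)"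
          using Metzler[OF rT(1)] less_imp_le[OF e_pos] by (intro sum_mono2) auto
        then show ?thesis by simp
      qed
      also have "\<dots> = (A r *v e r) $ i"
        by (simp add: matrix_vector_mult_def)
      also have "\<dots> \<le> ((c + \<eta>) *\<^sub>R \<xi>' r - ?g r) $ i"
      proof -
        have "w r \<le> c *\<^sub>R 1"
          using w rT r by blast
        also have "\<dots> \<le> (c + \<eta>) *\<^sub>R 1"
          using \<open>0 < \<eta>\<close> by (simp add: less_eq_vec_def)
        finally have "E r *v w r \<le> E r *v ((c + \<eta>) *\<^sub>R 1)"
          by (rule matrix_vector_mult_mono[OF E_nonneg[OF rT(1)]])
        moreover have "(c + \<eta>) *\<^sub>R (A r *v \<xi> r + E r *v 1) \<le> (c + \<eta>) *\<^sub>R \<xi>' r"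
          using flow_supersolution[OF rT(1)] c \<open>0 < \<eta>\<close> by (intro scaleR_left_mono) auto
        ultimately have "A r *v e r \<le> (c + \<eta>) *\<^sub>R \<xi>' r - ?g r"
          unfolding e_def by (simp add: less_eq_vec_def matrix_vector_mult_diff_distrib
              matrix_vector_mult_scaleR algebra_simps) (smt (verit, best))
        then show ?thesis by (simp add: less_eq_vec_def)
      qed
      finally show "- L * e r $ i \<le> ((c + \<eta>) *\<^sub>R \<xi>' r - ?g r) $ i" .
    qed
    then show "((c + \<eta>) *\<^sub>R \<xi> s - v s) $ i - L * integral {s..\<tau>} (\<lambda>r. ((c + \<eta>) *\<^sub>R \<xi> r - v r) $ i)
        \<le> ((c + \<eta>) *\<^sub>R \<xi> \<tau> - v \<tau>) $ i"
      unfolding e_def .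
  qed
  have "v \<tau> $ i \<le> c * \<xi> \<tau> $ i" for i
  proof (rule field_le_epsilon)
    fix \<delta> :: real assume "0 < \<delta>"
    have "0 < \<xi> \<tau> $ i" using \<xi>_pos \<tau> T by auto
    with strict[of "\<delta> / \<xi> \<tau> $ i" i] \<open>0 < \<delta>\<close> show "v \<tau> $ i \<le> c * \<xi> \<tau> $ i + \<delta>"
      by (simp add: distrib_right)
  qed
  then show ?thesis by (simp add: less_eq_vec_def)
qed

lemma flow_bound:
  assumes T: "T \<le> Tmax"
    and flow: "\<And>\<tau>. \<tau> \<in> {0..T} \<Longrightarrow>
      ((\<lambda>s. A s *v v s + E s *v w s) has_integral (v \<tau> - v 0)) {0..\<tau>}"
    and N: "negligible N" and w: "\<And>s. s \<in> {0..T} - N \<Longrightarrow> \<bar>w s\<bar> \<le> c *\<^sub>R 1"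
    and c: "0 \<le> c" and init: "\<bar>v 0\<bar> \<le> c *\<^sub>R \<xi> 0"
    and \<tau>: "\<tau> \<in> {0..T}"
  shows "\<bar>v \<tau>\<bar> \<le> c *\<^sub>R \<xi> \<tau>"
proof -
  have "v \<tau> \<le> c *\<^sub>R \<xi> \<tau>"
    by (rule flow_upper_bound[OF T flow N _ c _ \<tau>]) (use w init in \<open>auto simp: abs_le_iff\<close>)
  moreover have "- v \<tau> \<le> c *\<^sub>R \<xi> \<tau>"
  proof (rule flow_upper_bound[where v = "\<lambda>s. - v s" and w = "\<lambda>s. - w s", OF T _ N _ c _ \<tau>])
    show "((\<lambda>s. A s *v - v s + E s *v - w s) has_integral - v \<tau> - - v 0) {0..\<tau>}"
      if "\<tau> \<in> {0..T}" for \<tau>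
      using has_integral_neg[OF flow[OF that]]
      by (simp add: matrix_vector_mult_uminus algebra_simps)
  qed (use w init in \<open>auto simp: abs_le_iff\<close>)
  ultimately show ?thesis by (simp add: abs_le_iff)
qed

section \<open>Comparison across impulses\<close>

lemma \<mu>_nonneg: "0 \<le> \<mu>"
proof -
  have "0 \<le> \<xi> Tmin"
    using \<xi>_pos[of Tmin] dwell by (simp add: less_eq_vec_def less_imp_le)
  also have "\<dots> \<le> \<mu>"
    using \<xi>_le_\<mu> dwell by simp
  finally show ?thesis .
qed

text \<open>
  The closed-loop counterpart of \<open>is_trajectory\<close>, without the outputs.  The state just after the
  impulse at \<open>t k\<close>, including the initial state for \<open>k = 0\<close>, is \<open>Lim (at_right (t k)) x\<close>.
\<close>
definition evolution ::
  "(nat \<Rightarrow> real) \<Rightarrow> (real \<Rightarrow> real^'pc) \<Rightarrow> (nat \<Rightarrow> real^'pd) \<Rightarrow> (real \<Rightarrow> real^'n) \<Rightarrow> bool" where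
  "evolution t w wd x \<longleftrightarrow>
     (x \<longlongrightarrow> x 0) (at_right 0) \<and>
     (\<forall>k. \<forall>\<tau>\<in>{0<..t (Suc k) - t k}.
        ((\<lambda>s. A s *v x (t k + s) + E s *v w (t k + s))
           has_integral (x (t k + \<tau>) - Lim (at_right (t k)) x)) {0..\<tau>}) \<and>
     (\<forall>k\<ge>1. (x \<longlongrightarrow> J *v x (t k) + Ed *v wd k) (at_right (t k)))"

lemma initial_limit:
  assumes "range_dwell_time Tmin Tmax t" "evolution t w wd x"
  shows "Lim (at_right (t 0)) x = x 0"
  using assms by (intro tendsto_Lim) (simp_all add: range_dwell_time_def evolution_def)

text \<open>
  Transfers \<open>flow_bound\<close> to one interval between impulses.  The value \<open>x (t k)\<close> still belongs to
  the previous interval and has to be replaced by the state after the impulse.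
\<close>
lemma interval_bound:
  assumes t: "range_dwell_time Tmin Tmax t" and x: "evolution t w wd x"
    and N: "negligible N" and w: "\<And>s. 0 \<le> s \<Longrightarrow> s \<notin> N \<Longrightarrow> \<bar>w s\<bar> \<le> c *\<^sub>R 1"
    and c: "0 \<le> c"
    and post: "\<bar>Lim (at_right (t k)) x\<bar> \<le> c *\<^sub>R \<xi> 0"
    and \<tau>: "\<tau> \<in> {0<..t (Suc k) - t k}"
  shows "\<bar>x (t k + \<tau>)\<bar> \<le> c *\<^sub>R \<xi> \<tau>"
proof -
  define v where "v \<tau> = (if \<tau> = 0 then Lim (at_right (t k)) x else x (t k + \<tau>))" for \<tau>
  have "0 \<le> t k"
    using dwell_time_nonneg[OF t] dwell by simp
  have "\<bar>v \<tau>\<bar> \<le> c *\<^sub>R \<xi> \<tau>"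
  proof (rule flow_bound[where T = "t (Suc k) - t k" and N = "(+) (- t k) ` N" and w = "\<lambda>s. w (t k + s)"])
    show "t (Suc k) - t k \<le> Tmax"
      using t by (simp add: range_dwell_time_def)
    show "((\<lambda>s. A s *v v s + E s *v w (t k + s)) has_integral (v \<tau> - v 0)) {0..\<tau>}"
      if "\<tau> \<in> {0..t (Suc k) - t k}" for \<tau>
    proof (cases "\<tau> = 0")
      case False
      then have "((\<lambda>s. A s *v x (t k + s) + E s *v w (t k + s)) has_integral (v \<tau> - v 0)) {0..\<tau>}"
        using x that by (auto simp: evolution_def v_def)
      then show ?thesis
        by (rule has_integral_spike_finite[of "{0}", rotated 2]) (auto simp: v_def)
    qed (simp add: has_integral_refl)
    show "negligible ((+) (- t k) ` N)"
      by (rule negligible_translation[OF N])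
    show "\<bar>w (t k + s)\<bar> \<le> c *\<^sub>R 1" if "s \<in> {0..t (Suc k) - t k} - (+) (- t k) ` N" for s
    proof (rule w)
      show "t k + s \<notin> N"
        using that image_eqI[of s "(+) (- t k)" "t k + s" N] by auto
    qed (use that \<open>0 \<le> t k\<close> in auto)
  qed (use \<tau> c post in \<open>auto simp: v_def\<close>)
  then show ?thesis using \<tau> by (simp add: v_def)
qed

lemma pre_jump_bound:
  assumes t: "range_dwell_time Tmin Tmax t" and x: "evolution t w wd x"
    and N: "negligible N" and w: "\<And>s. 0 \<le> s \<Longrightarrow> s \<notin> N \<Longrightarrow> \<bar>w s\<bar> \<le> c *\<^sub>R 1"
    and c: "0 \<le> c"
    and post: "\<bar>Lim (at_right (t k)) x\<bar> \<le> c *\<^sub>R \<xi> 0"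
  shows "\<bar>x (t (Suc k))\<bar> \<le> c *\<^sub>R \<mu>"
proof -
  have T: "t (Suc k) - t k \<in> {Tmin..Tmax}"
    using t by (simp add: range_dwell_time_def)
  have "\<bar>x (t k + (t (Suc k) - t k))\<bar> \<le> c *\<^sub>R \<xi> (t (Suc k) - t k)"
    by (rule interval_bound[OF t x N w c post]) (use T dwell in auto)
  also have "\<dots> \<le> c *\<^sub>R \<mu>"
    by (intro scaleR_left_mono \<xi>_le_\<mu> T c)
  finally show ?thesis by simp
qed

text \<open>
  The margin in the impulse inequality scales with \<open>c\<close>, because flow and impulse are both
  homogeneous in state and inputs together.
\<close>
lemma post_jump_bound:
  assumes t: "range_dwell_time Tmin Tmax t" and x: "evolution t w wd x"
    and N: "negligible N" and w: "\<And>s. 0 \<le> s \<Longrightarrow> s \<notin> N \<Longrightarrow> \<bar>w s\<bar> \<le> c *\<^sub>R 1"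
    and wd: "\<bar>wd (Suc k)\<bar> \<le> c *\<^sub>R 1" and c: "0 \<le> c"
    and post: "\<bar>Lim (at_right (t k)) x\<bar> \<le> c *\<^sub>R \<xi> 0"
  shows "\<bar>Lim (at_right (t (Suc k))) x\<bar> \<le> c *\<^sub>R (\<xi> 0 - \<epsilon> *\<^sub>R 1)"
proof -
  have "Lim (at_right (t (Suc k))) x = J *v x (t (Suc k)) + Ed *v wd (Suc k)"
    using x by (intro tendsto_Lim) (simp_all add: evolution_def)
  also have "\<bar>\<dots>\<bar> \<le> \<bar>J *v x (t (Suc k))\<bar> + \<bar>Ed *v wd (Suc k)\<bar>"
    by (rule abs_triangle_ineq)
  also have "\<dots> \<le> J *v (c *\<^sub>R \<mu>) + Ed *v (c *\<^sub>R 1)"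
    by (intro add_mono abs_matrix_vector_mult_le J_nonneg Ed_nonneg wd pre_jump_bound[OF t x N w c post])
  also have "\<dots> = c *\<^sub>R (J *v \<mu> + Ed *v 1)"
    by (simp add: matrix_vector_mult_scaleR scaleR_right_distrib)
  also have "\<dots> \<le> c *\<^sub>R (\<xi> 0 - \<epsilon> *\<^sub>R 1)"
    using jump_supersolution by (intro scaleR_left_mono c) (simp add: algebra_simps)
  finally show ?thesis .
qed

lemma invariant_bound:
  assumes t: "range_dwell_time Tmin Tmax t" and x: "evolution t w wd x"
    and N: "negligible N" and w: "\<And>s. 0 \<le> s \<Longrightarrow> s \<notin> N \<Longrightarrow> \<bar>w s\<bar> \<le> c *\<^sub>R 1"
    and wd: "\<And>k. 1 \<le> k \<Longrightarrow> \<bar>wd k\<bar> \<le> c *\<^sub>R 1" and c: "0 \<le> c"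
    and init: "\<bar>x 0\<bar> \<le> c *\<^sub>R \<xi> 0"
  shows "\<bar>Lim (at_right (t k)) x\<bar> \<le> c *\<^sub>R \<xi> 0"
proof (induction k)
  case 0
  show ?case using init initial_limit[OF t x] by simp
next
  case (Suc k)
  have "\<bar>Lim (at_right (t (Suc k))) x\<bar> \<le> c *\<^sub>R (\<xi> 0 - \<epsilon> *\<^sub>R 1)"
    by (rule post_jump_bound[OF t x N w wd c Suc]) auto
  also have "\<dots> \<le> c *\<^sub>R \<xi> 0"
    using \<epsilon>_pos by (intro scaleR_left_mono c) (simp add: less_eq_vec_def)
  finally show ?case .
qed

section \<open>Stability without inputs\<close>

text \<open>
  The additive margin becomes a contraction factor because all components of \<open>\<xi> 0\<close> are bounded by
  their maximum \<open>m\<close>, so that \<open>\<epsilon> \<ge> (\<epsilon> / m) * \<xi> 0 $ i\<close>.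
\<close>
lemma jump_contraction:
  obtains \<rho> where "0 \<le> \<rho>" "\<rho> < 1" "\<xi> 0 - \<epsilon> *\<^sub>R 1 \<le> \<rho> *\<^sub>R \<xi> 0"
proof -
  define m where "m = Max (range (\<lambda>i. \<xi> 0 $ i))"
  have m: "\<xi> 0 $ i \<le> m" for i
    unfolding m_def by (rule Max_ge) auto
  have \<xi>0: "0 < \<xi> 0 $ i" for i
    using \<xi>_pos[of 0 i] dwell by simp
  \<comment> \<open>Positivity of the system limits the margin, so that the contraction factor is not negative.\<close>
  have "0 \<le> J *v \<mu> + Ed *v 1"
  proof (rule add_nonneg_nonneg)
    show "0 \<le> J *v \<mu>"
      using matrix_vector_mult_mono[OF J_nonneg \<mu>_nonneg] by simp
    have "(0 :: real^'pd) \<le> 1" by (simp add: less_eq_vec_def)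
    from matrix_vector_mult_mono[OF Ed_nonneg this] show "0 \<le> Ed *v 1" by simp
  qed
  then have "0 \<le> (J *v \<mu> + Ed *v 1) $ undefined"
    by (simp add: less_eq_vec_def)
  moreover have "(J *v \<mu> + Ed *v 1 + \<epsilon> *\<^sub>R 1) $ undefined \<le> \<xi> 0 $ undefined"
    using jump_supersolution unfolding less_eq_vec_def by blast
  ultimately have "\<epsilon> \<le> m"
    using m[of undefined] by simp
  then have "0 < m" using \<epsilon>_pos by simp
  show ?thesis
  proof (rule that[of "1 - \<epsilon> / m"])
    show "0 \<le> 1 - \<epsilon> / m" "1 - \<epsilon> / m < 1"
      using \<open>\<epsilon> \<le> m\<close> \<open>0 < m\<close> \<epsilon>_pos by (simp_all add: field_simps)
    have "\<epsilon> / m * \<xi> 0 $ i \<le> \<epsilon>" for i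
      using m[of i] \<open>0 < m\<close> \<epsilon>_pos by (simp add: field_simps)
    then show "\<xi> 0 - \<epsilon> *\<^sub>R 1 \<le> (1 - \<epsilon> / m) *\<^sub>R \<xi> 0"
      by (simp add: less_eq_vec_def algebra_simps)
  qed
qed

lemma free_decay:
  assumes t: "range_dwell_time Tmin Tmax t" and x: "evolution t (\<lambda>_. 0) (\<lambda>_. 0) x"
    and \<rho>: "0 \<le> \<rho>" "\<xi> 0 - \<epsilon> *\<^sub>R 1 \<le> \<rho> *\<^sub>R \<xi> 0"
    and c: "0 \<le> c" and init: "\<bar>x 0\<bar> \<le> c *\<^sub>R \<xi> 0"
  shows "\<bar>Lim (at_right (t k)) x\<bar> \<le> (c * \<rho> ^ k) *\<^sub>R \<xi> 0"
proof (induction k)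
  case 0
  show ?case using init initial_limit[OF t x] by simp
next
  case (Suc k)
  have nonneg: "0 \<le> c * \<rho> ^ k" using c \<rho> by simp
  have "(0 :: real^'pc) \<le> (c * \<rho> ^ k) *\<^sub>R 1" "(0 :: real^'pd) \<le> (c * \<rho> ^ k) *\<^sub>R 1"
    using nonneg by (simp_all add: less_eq_vec_def)
  then have "\<bar>Lim (at_right (t (Suc k))) x\<bar> \<le> (c * \<rho> ^ k) *\<^sub>R (\<xi> 0 - \<epsilon> *\<^sub>R 1)"
    by (intro post_jump_bound[OF t x negligible_empty _ _ nonneg Suc]) auto
  also have "\<dots> \<le> (c * \<rho> ^ k) *\<^sub>R (\<rho> *\<^sub>R \<xi> 0)"
    by (intro scaleR_left_mono \<rho> nonneg)
  finally show ?case by (simp add: algebra_simps)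
qed

lemma free_bound:
  assumes t: "range_dwell_time Tmin Tmax t" and x: "evolution t (\<lambda>_. 0) (\<lambda>_. 0) x"
    and \<rho>: "0 \<le> \<rho>" "\<xi> 0 - \<epsilon> *\<^sub>R 1 \<le> \<rho> *\<^sub>R \<xi> 0"
    and c: "0 \<le> c" and init: "\<bar>x 0\<bar> \<le> c *\<^sub>R \<xi> 0"
    and \<tau>: "\<tau> \<in> {0<..t (Suc k) - t k}"
  shows "norm (x (t k + \<tau>)) \<le> c * \<rho> ^ k * norm (\<xi> \<tau>)"
proof -
  have nonneg: "0 \<le> c * \<rho> ^ k" using c \<rho> by simp
  have "(0 :: real^'pc) \<le> (c * \<rho> ^ k) *\<^sub>R 1"
    using nonneg by (simp add: less_eq_vec_def)
  then have "\<bar>x (t k + \<tau>)\<bar> \<le> (c * \<rho> ^ k) *\<^sub>R \<xi> \<tau>"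
    by (intro interval_bound[OF t x negligible_empty _ nonneg free_decay[OF t x \<rho> c init] \<tau>]) auto
  then have "\<bar>x (t k + \<tau>) $ i\<bar> \<le> \<bar>((c * \<rho> ^ k) *\<^sub>R \<xi> \<tau>) $ i\<bar>" for i
    unfolding less_eq_vec_def abs_vec_def by (metis abs_ge_self order_trans vec_lambda_beta)
  then have "norm (x (t k + \<tau>)) \<le> norm ((c * \<rho> ^ k) *\<^sub>R \<xi> \<tau>)"
    by (intro norm_le_componentwise_cart) simp
  with c \<rho> show ?thesis by (simp add: abs_mult)
qed

text \<open>
  Lets stability and attractivity start from a norm bound on the initial state; \<open>m\<close> is the least
  component of \<open>\<xi> 0\<close>.
\<close>
lemma initial_bound:
  obtains m where "0 < m" "\<And>x0. \<bar>x0\<bar> \<le> (norm x0 / m) *\<^sub>R \<xi> 0"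
proof -
  define m where "m = Min (range (\<lambda>i. \<xi> 0 $ i))"
  have m: "m \<le> \<xi> 0 $ i" for i
    unfolding m_def by (rule Min_le) auto
  have "0 < m"
    unfolding m_def using \<xi>_pos[of 0] dwell by (subst Min_gr_iff) auto
  have "\<bar>x0\<bar> \<le> (norm x0 / m) *\<^sub>R \<xi> 0" for x0 :: "real^'n"
  proof -
    have "\<bar>x0 $ i\<bar> \<le> norm x0 / m * \<xi> 0 $ i" for i
    proof -
      have "\<bar>x0 $ i\<bar> \<le> norm x0" by (rule component_le_norm_cart)
      also have "norm x0 = norm x0 / m * m" using \<open>0 < m\<close> by simp
      also have "\<dots> \<le> norm x0 / m * \<xi> 0 $ i"
        using m[of i] \<open>0 < m\<close> by (intro mult_left_mono) auto
      finally show ?thesis .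
    qed
    then show ?thesis by (simp add: less_eq_vec_def abs_vec_def)
  qed
  with \<open>0 < m\<close> show ?thesis by (rule that)
qed

lemma \<xi>_bounded: obtains K where "0 < K" "\<And>\<tau>. \<tau> \<in> {0..Tmax} \<Longrightarrow> norm (\<xi> \<tau>) \<le> K"
proof -
  have "compact (\<xi> ` {0..Tmax})"
    by (intro compact_continuous_image \<xi>_cont compact_Icc)
  then obtain K where "0 < K" "\<forall>y \<in> \<xi> ` {0..Tmax}. norm y \<le> K"
    using compact_imp_bounded bounded_pos by blast
  then show ?thesis
    by (intro that[of K]) auto
qed

lemma free_stability:
  assumes "0 < e"
  obtains d where "0 < d"
    "\<And>t x s. range_dwell_time Tmin Tmax t \<Longrightarrow> evolution t (\<lambda>_. 0) (\<lambda>_. 0) x \<Longrightarrow>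
       norm (x 0) < d \<Longrightarrow> 0 \<le> s \<Longrightarrow> norm (x s) < e"
proof -
  obtain \<rho> where \<rho>: "0 \<le> \<rho>" "\<rho> < 1" "\<xi> 0 - \<epsilon> *\<^sub>R 1 \<le> \<rho> *\<^sub>R \<xi> 0"
    using jump_contraction by blast
  obtain m where m: "0 < m" "\<And>x0. \<bar>x0\<bar> \<le> (norm x0 / m) *\<^sub>R \<xi> 0"
    using initial_bound by blast
  obtain K where K: "0 < K" "\<And>\<tau>. \<tau> \<in> {0..Tmax} \<Longrightarrow> norm (\<xi> \<tau>) \<le> K"
    using \<xi>_bounded by blast
  show ?thesis
  \<comment> \<open>The second bound makes the constant \<open>norm (x 0) / m\<close> smaller than \<open>e / K\<close>; the first one
    covers the initial value itself.\<close>
  proof (rule that[of "min e (e * m / K)"])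
    show "0 < min e (e * m / K)" using assms m K by simp
    fix t x and s :: real
    assume t: "range_dwell_time Tmin Tmax t" and x: "evolution t (\<lambda>_. 0) (\<lambda>_. 0) x"
      and x0: "norm (x 0) < min e (e * m / K)" and "0 \<le> s"
    show "norm (x s) < e"
    proof (cases "s = 0")
      case True
      with x0 show ?thesis by simp
    next
      case False
      with \<open>0 \<le> s\<close> have "0 < s" by simp
      then obtain k \<tau> where \<tau>: "\<tau> \<in> {0<..t (Suc k) - t k}" "s = t k + \<tau>"
        using dwell_time_cover[OF t dwell(1)] by blast
      have "\<tau> \<in> {0..Tmax}" using \<tau> t by (auto simp: range_dwell_time_def intro: order_trans)
      have "norm (x s) \<le> norm (x 0) / m * \<rho> ^ k * norm (\<xi> \<tau>)"
        unfolding \<tau>(2) by (rule free_bound[OF t x \<rho>(1,3) _ m(2) \<tau>(1)]) (use m in simp)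
      also have "\<dots> \<le> norm (x 0) / m * 1 * K"
        using \<rho> m K(1) K(2)[OF \<open>\<tau> \<in> {0..Tmax}\<close>] by (intro mult_mono mult_left_mono power_le_one) auto
      also have "\<dots> < e"
        using x0 m K by (simp add: field_simps)
      finally show ?thesis .
    qed
  qed
qed

lemma free_attractivity:
  assumes t: "range_dwell_time Tmin Tmax t" and x: "evolution t (\<lambda>_. 0) (\<lambda>_. 0) x"
  shows "(x \<longlongrightarrow> 0) at_top"
proof (rule tendstoI)
  fix e :: real assume "0 < e"
  obtain \<rho> where \<rho>: "0 \<le> \<rho>" "\<rho> < 1" "\<xi> 0 - \<epsilon> *\<^sub>R 1 \<le> \<rho> *\<^sub>R \<xi> 0"
    using jump_contraction by blast
  obtain m where m: "0 < m" "\<And>x0. \<bar>x0\<bar> \<le> (norm x0 / m) *\<^sub>R \<xi> 0"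
    using initial_bound by blast
  obtain K where K: "0 < K" "\<And>\<tau>. \<tau> \<in> {0..Tmax} \<Longrightarrow> norm (\<xi> \<tau>) \<le> K"
    using \<xi>_bounded by blast
  define C where "C = norm (x 0) / m * K"
  have "0 \<le> C" unfolding C_def using m K by simp
  have "(\<lambda>k. C * \<rho> ^ k) \<longlonglongrightarrow> C * 0"
    by (intro tendsto_mult tendsto_const LIMSEQ_realpow_zero \<rho>)
  then have "\<forall>\<^sub>F k in sequentially. C * \<rho> ^ k < e"
    using \<open>0 < e\<close> by (auto dest: order_tendstoD(2))
  then obtain n where n: "\<And>k. n \<le> k \<Longrightarrow> C * \<rho> ^ k < e"
    by (auto simp: eventually_sequentially)
  have "dist (x s) 0 < e" if s: "max 0 (t n) < s" for s
  proof -
    have "0 < s" using s by simp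
    then obtain k \<tau> where \<tau>: "\<tau> \<in> {0<..t (Suc k) - t k}" "s = t k + \<tau>"
      using dwell_time_cover[OF t dwell(1)] by blast
    have "\<tau> \<in> {0..Tmax}" using \<tau> t by (auto simp: range_dwell_time_def intro: order_trans)
    have "t n < t (Suc k)" using s \<tau> by auto
    then have "n \<le> k"
      using strict_mono_less[OF dwell_time_strict_mono[OF t dwell(1)]] by (simp add: less_Suc_eq_le)
    have "norm (x s) \<le> norm (x 0) / m * \<rho> ^ k * norm (\<xi> \<tau>)"
      unfolding \<tau>(2) by (rule free_bound[OF t x \<rho>(1,3) _ m(2) \<tau>(1)]) (use m in simp)
    also have "\<dots> \<le> norm (x 0) / m * \<rho> ^ k * K"
      using \<rho> m K(1) K(2)[OF \<open>\<tau> \<in> {0..Tmax}\<close>] by (intro mult_left_mono) auto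
    also have "\<dots> = C * \<rho> ^ k" by (simp add: C_def)
    also have "\<dots> < e" using n \<open>n \<le> k\<close> by simp
    finally show ?thesis by simp
  qed
  then show "\<forall>\<^sub>F s in at_top. dist (x s) 0 < e"
    unfolding eventually_at_top_dense by blast
qed

section \<open>Gains from the inputs to the outputs\<close>

lemma evolution_continuous:
  assumes t: "range_dwell_time Tmin Tmax t" and x: "evolution t w wd x"
  shows "continuous_on {t k<..t (Suc k)} x"
proof -
  let ?T = "t (Suc k) - t k" and ?g = "\<lambda>s. A s *v x (t k + s) + E s *v w (t k + s)"
  have flow: "(?g has_integral (x (t k + \<tau>) - Lim (at_right (t k)) x)) {0..\<tau>}" if "\<tau> \<in> {0<..?T}" for \<tau>
    using x that by (simp add: evolution_def)
  have "0 < ?T"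
    using strict_monoD[OF dwell_time_strict_mono[OF t dwell(1)], of k "Suc k"] by simp
  then have "?g integrable_on {0..?T}"
    using flow[of ?T] by (auto simp: integrable_on_def)
  then have "continuous_on {0..?T} (\<lambda>\<tau>. integral {0..\<tau>} ?g)"
    by (rule indefinite_integral_continuous_1)
  then have "continuous_on {t k<..t (Suc k)} (\<lambda>s. integral {0..s - t k} ?g)"
    by (rule continuous_on_compose2) (auto intro!: continuous_intros)
  then have "continuous_on {t k<..t (Suc k)} (\<lambda>s. Lim (at_right (t k)) x + integral {0..s - t k} ?g)"
    by (rule continuous_on_add[OF continuous_on_const])
  then show ?thesis
  proof (rule continuous_on_eq)
    fix s assume "s \<in> {t k<..t (Suc k)}"
    then show "Lim (at_right (t k)) x + integral {0..s - t k} ?g = x s"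
      using integral_unique[OF flow[of "s - t k"]] by simp
  qed
qed

text \<open>
  On each interval between impulses the output combines the continuous state and the measurable
  input with continuous coefficients; countably many such intervals and the point \<open>0\<close> make up the
  time axis.
\<close>
lemma output_measurable:
  fixes Cz :: "real \<Rightarrow> real^'n^'q::finite" and Fz :: "real \<Rightarrow> real^'pc^'q"
  assumes t: "range_dwell_time Tmin Tmax t" and x: "evolution t w wd x"
    and w: "w \<in> borel_measurable (lebesgue_on {0..})"
    and cont: "continuous_on {0..Tmax} Cz" "continuous_on {0..Tmax} Fz"
    and z: "\<And>k \<tau>. \<tau> \<in> {0<..t (Suc k) - t k} \<Longrightarrow>
      z (t k + \<tau>) = Cz \<tau> *v x (t k + \<tau>) + Fz \<tau> *v w (t k + \<tau>)"
  shows "z \<in> borel_measurable (lebesgue_on {0..})"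
proof (rule measurable_piecewise_restrict[where C = "insert {0} (range (\<lambda>k. {t k<..t (Suc k)}))"])
  show "space (lebesgue_on {0..}) \<subseteq> \<Union> (insert {0} (range (\<lambda>k. {t k<..t (Suc k)})))"
  proof
    fix s assume "s \<in> space (lebesgue_on {0 :: real..})"
    then consider "s = 0" | "0 < s" by force
    then show "s \<in> \<Union> (insert {0} (range (\<lambda>k. {t k<..t (Suc k)})))"
    proof cases
      case 2
      then obtain k \<tau> where "\<tau> \<in> {0<..t (Suc k) - t k}" "s = t k + \<tau>"
        by (rule dwell_time_cover[OF t dwell(1)])
      then have "s \<in> {t k<..t (Suc k)}" by auto
      then show ?thesis by blast
    qed simp
  qed
  show "\<Omega> \<inter> space (lebesgue_on {0..}) \<in> sets (lebesgue_on {0..})"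
    if "\<Omega> \<in> insert {0} (range (\<lambda>k. {t k<..t (Suc k)}))" for \<Omega>
  proof -
    have "\<Omega> \<in> sets lebesgue" using that by auto
    then have "\<Omega> \<inter> {0..} \<in> sets lebesgue" by (rule sets.Int) simp
    then show ?thesis by (simp add: sets_restrict_space_iff)
  qed
  fix \<Omega> assume \<Omega>: "\<Omega> \<in> insert {0} (range (\<lambda>k. {t k<..t (Suc k)}))"
  have t_nonneg: "0 \<le> t k" for k
    using dwell_time_nonneg[OF t] dwell by simp
  have sub: "\<Omega> \<subseteq> {0..}"
    using \<Omega> by (auto intro: order_trans[OF t_nonneg less_imp_le])
  have \<Omega>_leb: "\<Omega> \<in> sets lebesgue"
    using \<Omega> by auto
  have restrict: "restrict_space (lebesgue_on {0..}) \<Omega> = lebesgue_on \<Omega>"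
    using sub \<Omega>_leb by (subst restrict_restrict_space) (auto simp: Int_absorb1)
  have "z \<in> borel_measurable (lebesgue_on \<Omega>)"
  proof (cases "\<Omega> = {0}")
    case True
    then show ?thesis
      using continuous_imp_measurable_on_sets_lebesgue[OF continuous_on_sing] \<Omega>_leb by blast
  next
    case False
    with \<Omega> obtain k where k: "\<Omega> = {t k<..t (Suc k)}" by blast
    have T: "t (Suc k) - t k \<le> Tmax" using t by (simp add: range_dwell_time_def)
    have shift: "(\<lambda>s. P (s - t k)) \<in> borel_measurable (lebesgue_on \<Omega>)"
      if "continuous_on {0..Tmax} P" for P :: "real \<Rightarrow> real^'a^'b"
    proof (rule continuous_imp_measurable_on_sets_lebesgue[OF _ \<Omega>_leb])
      show "continuous_on \<Omega> (\<lambda>s. P (s - t k))"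
        by (rule continuous_on_compose2[OF that]) (use T k in \<open>auto intro!: continuous_intros\<close>)
    qed
    have "x \<in> borel_measurable (lebesgue_on \<Omega>)"
      using continuous_imp_measurable_on_sets_lebesgue[OF evolution_continuous[OF t x] ] \<Omega>_leb k by blast
    moreover have "w \<in> borel_measurable (lebesgue_on \<Omega>)"
      by (rule measurable_restrict_mono[OF w sub])
    ultimately have "(\<lambda>s. Cz (s - t k) *v x s + Fz (s - t k) *v w s) \<in> borel_measurable (lebesgue_on \<Omega>)"
      by (intro borel_measurable_add borel_measurable_matrix_vector_mult shift cont)
    moreover have "z s = Cz (s - t k) *v x s + Fz (s - t k) *v w s" if "s \<in> \<Omega>" for s
      using z[of "s - t k" k] that k by simp
    ultimately show ?thesis
      by (subst measurable_cong[where g = "\<lambda>s. Cz (s - t k) *v x s + Fz (s - t k) *v w s"]) simp_all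
  qed
  with restrict show "z \<in> borel_measurable (restrict_space (lebesgue_on {0..}) \<Omega>)"
    by simp
qed simp

lemma continuous_output_gain:
  fixes Cz :: "real \<Rightarrow> real^'n^'q::finite" and Fz :: "real \<Rightarrow> real^'pc^'q"
  assumes t: "range_dwell_time Tmin Tmax t" and x: "evolution t w wd x" and x0: "x 0 = 0"
    and w: "w \<in> borel_measurable (lebesgue_on {0..})" "L_infinity_norm w \<le> ereal 1"
    and wd: "l_infinity_norm wd \<le> ereal 1"
    and cont: "continuous_on {0..Tmax} Cz" "continuous_on {0..Tmax} Fz"
    and nonneg: "\<And>\<tau>. \<tau> \<in> {0..Tmax} \<Longrightarrow> 0 \<le> Cz \<tau>" "\<And>\<tau>. \<tau> \<in> {0..Tmax} \<Longrightarrow> 0 \<le> Fz \<tau>"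
    and gain: "\<And>\<tau>. \<tau> \<in> {0..Tmax} \<Longrightarrow> Cz \<tau> *v \<xi> \<tau> + Fz \<tau> *v 1 \<le> \<gamma> *\<^sub>R 1"
    and z: "\<And>k \<tau>. \<tau> \<in> {0<..t (Suc k) - t k} \<Longrightarrow>
      z (t k + \<tau>) = Cz \<tau> *v x (t k + \<tau>) + Fz \<tau> *v w (t k + \<tau>)"
  shows "L_infinity_norm z \<le> ereal \<gamma>"
proof -
  obtain N where N: "negligible N" "\<And>s. 0 \<le> s \<Longrightarrow> s \<notin> N \<Longrightarrow> \<bar>w s\<bar> \<le> 1 *\<^sub>R 1"
    using L_infinity_norm_le_imp[OF w(2)] by blast
  have init: "\<bar>x 0\<bar> \<le> 1 *\<^sub>R \<xi> 0"
    using \<xi>_pos[of 0] dwell x0 by (simp add: less_eq_vec_def less_imp_le)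
  have wd': "\<bar>wd k\<bar> \<le> 1 *\<^sub>R 1" if "1 \<le> k" for k
    using wd that by (simp only: l_infinity_norm_le_iff)
  show ?thesis
  proof (rule L_infinity_norm_leI[where N = "insert 0 N"])
    show "z \<in> borel_measurable (lebesgue_on {0..})"
      by (rule output_measurable[OF t x w(1) cont z])
    show "negligible (insert 0 N)" using N by simp
    fix s :: real assume s: "0 \<le> s" "s \<notin> insert 0 N"
    then have "0 < s" by auto
    then obtain k \<tau> where \<tau>: "\<tau> \<in> {0<..t (Suc k) - t k}" "s = t k + \<tau>"
      using dwell_time_cover[OF t dwell(1)] by blast
    have \<tau>T: "\<tau> \<in> {0..Tmax}" using \<tau> t by (auto simp: range_dwell_time_def intro: order_trans)
    have "\<bar>x s\<bar> \<le> \<xi> \<tau>"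
      using interval_bound[OF t x N _ invariant_bound[OF t x N wd' _ init] \<tau>(1)] \<tau>(2) by simp
    moreover have "\<bar>w s\<bar> \<le> 1"
      using N(2)[of s] s by simp
    ultimately show "\<bar>z s\<bar> \<le> \<gamma> *\<^sub>R 1"
      using abs_output_le[OF nonneg(1)[OF \<tau>T] nonneg(2)[OF \<tau>T] _ _ gain[OF \<tau>T]] z[OF \<tau>(1)] \<tau>(2) by simp
  qed
qed

lemma discrete_output_gain:
  fixes Cz :: "real^'n^'q::finite" and Fz :: "real^'pd^'q"
  assumes t: "range_dwell_time Tmin Tmax t" and x: "evolution t w wd x" and x0: "x 0 = 0"
    and w: "L_infinity_norm w \<le> ereal 1" and wd: "l_infinity_norm wd \<le> ereal 1"
    and nonneg: "0 \<le> Cz" "0 \<le> Fz" and gain: "Cz *v \<mu> + Fz *v 1 \<le> \<gamma> *\<^sub>R 1"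
    and z: "\<And>k. 1 \<le> k \<Longrightarrow> z k = Cz *v x (t k) + Fz *v wd k"
  shows "l_infinity_norm z \<le> ereal \<gamma>"
  unfolding l_infinity_norm_le_iff
proof (intro allI impI)
  obtain N where N: "negligible N" "\<And>s. 0 \<le> s \<Longrightarrow> s \<notin> N \<Longrightarrow> \<bar>w s\<bar> \<le> 1 *\<^sub>R 1"
    using L_infinity_norm_le_imp[OF w] by blast
  have init: "\<bar>x 0\<bar> \<le> 1 *\<^sub>R \<xi> 0"
    using \<xi>_pos[of 0] dwell x0 by (simp add: less_eq_vec_def less_imp_le)
  have wd': "\<bar>wd k\<bar> \<le> 1 *\<^sub>R 1" if "1 \<le> k" for k
    using wd that by (simp only: l_infinity_norm_le_iff)
  fix k :: nat assume "1 \<le> k"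
  then obtain j where j: "k = Suc j" by (cases k) auto
  have "\<bar>x (t k)\<bar> \<le> \<mu>"
    using pre_jump_bound[OF t x N _ invariant_bound[OF t x N wd' _ init]] j by simp
  then show "\<bar>z k\<bar> \<le> \<gamma> *\<^sub>R 1"
    using abs_output_le[OF nonneg _ _ gain] z[OF \<open>1 \<le> k\<close>] wd'[OF \<open>1 \<le> k\<close>] by simp
qed

end

section \<open>The closed loop\<close>

theorem theorem4p4:
  fixes S :: "('n::finite, 'mc::finite, 'md::finite, 'pc::finite, 'pd::finite, 'qc::finite,
                'qd::finite) impulsive_system"
    and Tmin Tmax :: real
    and X X' :: "real \<Rightarrow> real^'n^'n"
    and Uc Kc :: "real \<Rightarrow> real^'n^'mc"
    and M :: "real^'n^'n"
    and Ud Kd :: "real^'n^'md"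
    and \<epsilon> \<alpha> \<gamma> :: real
  assumes dwell: "0 < Tmin" "Tmin \<le> Tmax"
    and timer_functions:
      "continuous_on {0..Tmax} (A_c S)" "continuous_on {0..Tmax} (B_c S)"
      "continuous_on {0..Tmax} (E_c S)" "continuous_on {0..Tmax} (C_c S)"
      "continuous_on {0..Tmax} (D_c S)" "continuous_on {0..Tmax} (F_c S)"
      "continuous_on {0..Tmax} Uc" "continuous_on {0..Tmax} Kc"
    and nonneg:
      "\<And>\<tau>. \<tau> \<in> {0..Tmax} \<Longrightarrow> 0 \<le> E_c S \<tau>" "\<And>\<tau>. \<tau> \<in> {0..Tmax} \<Longrightarrow> 0 \<le> F_c S \<tau>"
      "0 \<le> E_d S" "0 \<le> F_d S"
    and X_diagonal: "\<And>\<tau>. \<tau> \<in> {0..Tmax} \<Longrightarrow> diagonal_matrix (X \<tau>)"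
    and X_deriv: "\<And>\<tau>. \<tau> \<in> {0..Tmax} \<Longrightarrow>
      (X has_vector_derivative X' \<tau>) (at \<tau> within {0..Tmax})"
    and X_0: "positive_definite (X 0)"
    and M: "diagonal_matrix M" "positive_definite M"
    and scalars: "\<epsilon> > 0" "\<alpha> > 0" "\<gamma> > 0"
    and X_le_M: "\<And>\<theta>. \<theta> \<in> {Tmin..Tmax} \<Longrightarrow> X \<theta> \<le> M"
    and positivity:
      "\<And>\<tau>. \<tau> \<in> {0..Tmax} \<Longrightarrow> 0 \<le> A_c S \<tau> ** X \<tau> + B_c S \<tau> ** Uc \<tau> + \<alpha> *\<^sub>R mat 1"
      "0 \<le> J_d S ** M + B_d S ** Ud"
      "\<And>\<tau>. \<tau> \<in> {0..Tmax} \<Longrightarrow> 0 \<le> C_c S \<tau> ** X \<tau> + D_c S \<tau> ** Uc \<tau>"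
      "0 \<le> C_d S ** M + D_d S ** Ud"
    and performance:
      "\<And>\<tau>. \<tau> \<in> {0..Tmax} \<Longrightarrow>
         (- X' \<tau> + A_c S \<tau> ** X \<tau> + B_c S \<tau> ** Uc \<tau>) *v 1 + E_c S \<tau> *v 1 \<le> 0"
      "(J_d S ** M + B_d S ** Ud - X 0 + \<epsilon> *\<^sub>R mat 1) *v 1 + E_d S *v 1 \<le> 0"
      "\<And>\<tau>. \<tau> \<in> {0..Tmax} \<Longrightarrow>
         (C_c S \<tau> ** X \<tau> + D_c S \<tau> ** Uc \<tau>) *v 1 + F_c S \<tau> *v 1 - \<gamma> *\<^sub>R 1 \<le> 0"
      "(C_d S ** M + D_d S ** Ud) *v 1 + F_d S *v 1 - \<gamma> *\<^sub>R 1 \<le> 0"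
    and gains:
      "\<And>\<tau>. \<tau> \<in> {0..Tmax} \<Longrightarrow> Kc \<tau> = Uc \<tau> ** matrix_inv (X \<tau>)"
      "Kd = Ud ** matrix_inv M"
  shows "asymptotically_stable S Kc Kd Tmin Tmax \<and> hybrid_gain S Kc Kd Tmin Tmax \<le> ereal \<gamma>"
proof -
  define Acl where "Acl \<tau> = A_c S \<tau> + B_c S \<tau> ** Kc \<tau>" for \<tau>
  define Ccl where "Ccl \<tau> = C_c S \<tau> + D_c S \<tau> ** Kc \<tau>" for \<tau>
  define Jcl where "Jcl = J_d S + B_d S ** Kd"
  define Cdcl where "Cdcl = C_d S + D_d S ** Kd"
  have zero_in: "0 \<in> {0..Tmax}" using dwell by simp
  have Acl_cont: "continuous_on {0..Tmax} Acl"
    unfolding Acl_def by (intro continuous_on_add continuous_on_matrix_mult timer_functions)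
  have Ccl_cont: "continuous_on {0..Tmax} Ccl"
    unfolding Ccl_def by (intro continuous_on_add continuous_on_matrix_mult timer_functions)
  have M_pos: "0 < M $ i $ i" for i
    by (rule positive_definite_diagonal_pos[OF M(2)])
  have X_super: "(A_c S \<tau> ** X \<tau> + B_c S \<tau> ** Uc \<tau>) *v 1 + E_c S \<tau> *v 1 \<le> X' \<tau> *v 1"
    if "\<tau> \<in> {0..Tmax}" for \<tau>
  proof -
    have "(- X' \<tau> + (A_c S \<tau> ** X \<tau> + B_c S \<tau> ** Uc \<tau>)) *v 1 =
        (A_c S \<tau> ** X \<tau> + B_c S \<tau> ** Uc \<tau>) *v 1 - X' \<tau> *v 1"
      by (simp flip: matrix_vector_mult_diff_rdistrib)
    with performance(1)[OF that] show ?thesis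
      by (simp add: add.assoc algebra_simps)
  qed
  have one_nonneg: "(0 :: real^'pc) \<le> 1" by (simp add: less_eq_vec_def)
  have X_pos: "0 < X \<tau> $ i $ i" if "\<tau> \<in> {0..Tmax}" for \<tau> i
  proof (rule diagonal_certificate_pos[OF X_diagonal X_deriv _ _ gains(1) positivity(1) _ that])
    show "0 < X 0 $ i $ i" for i
      by (rule positive_definite_diagonal_pos[OF X_0])
    show "continuous_on {0..Tmax} (\<lambda>\<tau>. A_c S \<tau> + B_c S \<tau> ** Kc \<tau>)"
      using Acl_cont by (simp add: Acl_def[abs_def])
    show "(A_c S \<tau> ** X \<tau> + B_c S \<tau> ** Uc \<tau>) *v 1 \<le> X' \<tau> *v 1" if "\<tau> \<in> {0..Tmax}" for \<tau>
    proof -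
      have "0 \<le> E_c S \<tau> *v 1"
        using matrix_vector_mult_mono[OF nonneg(1)[OF that] one_nonneg] by simp
      with X_super[OF that] show ?thesis
        by (meson le_add_same_cancel1 order_trans)
    qed
  qed
  have AX: "Acl \<tau> ** X \<tau> = A_c S \<tau> ** X \<tau> + B_c S \<tau> ** Uc \<tau>"
    and CX: "Ccl \<tau> ** X \<tau> = C_c S \<tau> ** X \<tau> + D_c S \<tau> ** Uc \<tau>" if "\<tau> \<in> {0..Tmax}" for \<tau>
    unfolding Acl_def Ccl_def
    using closed_loop_mult[OF X_diagonal[OF that] X_pos[OF that] gains(1)[OF that]] by blast+
  have JM: "Jcl ** M = J_d S ** M + B_d S ** Ud"
    and CM: "Cdcl ** M = C_d S ** M + D_d S ** Ud"
    unfolding Jcl_def Cdcl_def using closed_loop_mult[OF M(1) M_pos gains(2)] by blast+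
  interpret positive_impulsive Acl "E_c S" Jcl "E_d S" "\<lambda>\<tau>. X \<tau> *v 1" "\<lambda>\<tau>. X' \<tau> *v 1" "M *v 1"
    Tmin Tmax \<epsilon>
  proof
    show "0 < Tmin" "Tmin \<le> Tmax" "0 < \<epsilon>" "0 \<le> E_d S" by fact+
    show "continuous_on {0..Tmax} Acl" by (rule Acl_cont)
    show "0 \<le> Jcl"
      by (rule nonneg_of_mult_diagonal[OF M(1) M_pos]) (simp add: JM positivity)
    fix \<tau> assume \<tau>: "\<tau> \<in> {0..Tmax}"
    show "0 \<le> E_c S \<tau>" by (rule nonneg(1)[OF \<tau>])
    show "0 < (X \<tau> *v 1) $ i" for i
      by (simp add: diagonal_matrix_mult_one_nth[OF X_diagonal[OF \<tau>]] X_pos[OF \<tau>])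
    show "((\<lambda>\<tau>. X \<tau> *v 1) has_vector_derivative X' \<tau> *v 1) (at \<tau> within {0..Tmax})"
      by (rule has_vector_derivative_matrix_vector_mult[OF X_deriv[OF \<tau>]])
    show "Acl \<tau> *v (X \<tau> *v 1) + E_c S \<tau> *v 1 \<le> X' \<tau> *v 1"
      using X_super[OF \<tau>] by (simp add: matrix_vector_mul_assoc AX[OF \<tau>])
    show "0 \<le> Acl \<tau> $ i $ j" if "i \<noteq> j" for i j
    proof -
      have "0 \<le> (Acl \<tau> ** X \<tau> + \<alpha> *\<^sub>R mat 1) $ i $ j"
        using positivity(1)[OF \<tau>] AX[OF \<tau>] unfolding less_eq_vec_def by simp
      then have "0 \<le> Acl \<tau> $ i $ j * X \<tau> $ j $ j"
        using that by (simp add: diagonal_matrix_mult_nth[OF X_diagonal[OF \<tau>]] mat_def)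
      then show ?thesis
        using X_pos[OF \<tau>, of j] by (simp add: zero_le_mult_iff)
    qed
  next
    show "X \<theta> *v 1 \<le> M *v 1" if "\<theta> \<in> {Tmin..Tmax}" for \<theta>
      using X_le_M[OF that] by (simp add: less_eq_vec_def matrix_vector_mult_def sum_mono)
    have "(J_d S ** M + B_d S ** Ud - X 0 + \<epsilon> *\<^sub>R mat 1) *v 1 =
        (Jcl ** M) *v 1 - X 0 *v 1 + \<epsilon> *\<^sub>R 1"
      by (simp add: JM matrix_vector_mult_add_rdistrib matrix_vector_mult_diff_rdistrib
          flip: scaleR_matrix_vector_assoc)
    with performance(2) show "Jcl *v (M *v 1) + E_d S *v 1 + \<epsilon> *\<^sub>R 1 \<le> X 0 *v 1"
      by (simp add: matrix_vector_mul_assoc algebra_simps)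
  qed
  have closed_loop:
    "evolution t wc wd x"
    "\<And>k \<tau>. \<tau> \<in> {0<..t (Suc k) - t k} \<Longrightarrow>
       zc (t k + \<tau>) = Ccl \<tau> *v x (t k + \<tau>) + F_c S \<tau> *v wc (t k + \<tau>)"
    "\<And>k. 1 \<le> k \<Longrightarrow> zd k = Cdcl *v x (t k) + F_d S *v wd k"
    if cl: "closed_loop_trajectory S Kc Kd t wc wd x zc zd" for t wc wd x zc zd
  proof -
    obtain uc ud where fb: "state_feedback Kc Kd t uc ud x"
      and tr: "is_trajectory S t uc ud wc wd x zc zd"
      using cl by (auto simp: closed_loop_trajectory_def)
    have uc: "uc (t k + \<tau>) = Kc \<tau> *v x (t k + \<tau>)" if "\<tau> \<in> {0<..t (Suc k) - t k}" for k \<tau>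
      using fb that by (simp add: state_feedback_def)
    have ud: "ud k = Kd *v x (t k)" if "1 \<le> k" for k
      using fb that by (simp add: state_feedback_def)
    show "evolution t wc wd x"
      unfolding evolution_def
    proof (intro conjI allI ballI impI)
      show "(x \<longlongrightarrow> x 0) (at_right 0)"
        using tr by (simp add: is_trajectory_def)
    next
      fix k \<tau> assume \<tau>: "\<tau> \<in> {0<..t (Suc k) - t k}"
      have "((\<lambda>s. A_c S s *v x (t k + s) + B_c S s *v uc (t k + s) + E_c S s *v wc (t k + s))
           has_integral (x (t k + \<tau>) - Lim (at_right (t k)) x)) {0..\<tau>}"
        using tr \<tau> by (simp add: is_trajectory_def)
      then show "((\<lambda>s. Acl s *v x (t k + s) + E_c S s *v wc (t k + s))
           has_integral (x (t k + \<tau>) - Lim (at_right (t k)) x)) {0..\<tau>}"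
        \<comment> \<open>Feedback determines the control only for positive timer values.\<close>
      proof (rule has_integral_spike_finite[of "{0}", rotated 2])
        fix s assume "s \<in> {0..\<tau>} - {0}"
        then have "s \<in> {0<..t (Suc k) - t k}" using \<tau> by auto
        from uc[OF this] show "Acl s *v x (t k + s) + E_c S s *v wc (t k + s) =
            A_c S s *v x (t k + s) + B_c S s *v uc (t k + s) + E_c S s *v wc (t k + s)"
          by (simp add: Acl_def matrix_vector_mult_add_rdistrib matrix_vector_mul_assoc)
      qed simp
    next
      fix k :: nat assume k: "1 \<le> k"
      then have "(x \<longlongrightarrow> J_d S *v x (t k) + B_d S *v ud k + E_d S *v wd k) (at_right (t k))"
        using tr by (simp add: is_trajectory_def)
      then show "(x \<longlongrightarrow> Jcl *v x (t k) + E_d S *v wd k) (at_right (t k))"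
        by (simp add: ud[OF k] Jcl_def matrix_vector_mult_add_rdistrib matrix_vector_mul_assoc)
    qed
    show "zc (t k + \<tau>) = Ccl \<tau> *v x (t k + \<tau>) + F_c S \<tau> *v wc (t k + \<tau>)"
      if "\<tau> \<in> {0<..t (Suc k) - t k}" for k \<tau>
      using tr that
      by (simp add: is_trajectory_def uc Ccl_def matrix_vector_mult_add_rdistrib matrix_vector_mul_assoc)
    show "zd k = Cdcl *v x (t k) + F_d S *v wd k" if "1 \<le> k" for k
      using tr that
      by (simp add: is_trajectory_def ud Cdcl_def matrix_vector_mult_add_rdistrib matrix_vector_mul_assoc)
  qed
  have "asymptotically_stable S Kc Kd Tmin Tmax"
    unfolding asymptotically_stable_def
  proof (intro conjI allI impI)
    fix e :: real assume "0 < e"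
    then obtain d where "0 < d" and d: "\<And>t x s. range_dwell_time Tmin Tmax t \<Longrightarrow>
        evolution t (\<lambda>_. 0) (\<lambda>_. 0) x \<Longrightarrow> norm (x 0) < d \<Longrightarrow> 0 \<le> s \<Longrightarrow> norm (x s) < e"
      using free_stability by blast
    show "\<exists>d>0. \<forall>t x zc zd. range_dwell_time Tmin Tmax t \<and>
        closed_loop_trajectory S Kc Kd t (\<lambda>_. 0) (\<lambda>_. 0) x zc zd \<and> norm (x 0) < d \<longrightarrow>
        (\<forall>s\<ge>0. norm (x s) < e)"
      using \<open>0 < d\<close> d closed_loop(1) by blast
  next
    fix t x zc zd
    assume "range_dwell_time Tmin Tmax t \<and>
      closed_loop_trajectory S Kc Kd t (\<lambda>_. 0) (\<lambda>_. 0) x zc zd"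
    then show "(x \<longlongrightarrow> 0) at_top"
      using free_attractivity closed_loop(1) by blast
  qed
  moreover have "hybrid_gain S Kc Kd Tmin Tmax \<le> ereal \<gamma>"
    unfolding hybrid_gain_def
  proof (rule Sup_least, clarify)
    fix t wc wd x zc zd
    assume t: "range_dwell_time Tmin Tmax t"
      and wc: "wc \<in> borel_measurable (lebesgue_on {0..})"
      and w: "max (L_infinity_norm wc) (l_infinity_norm wd) = 1"
      and cl: "closed_loop_trajectory S Kc Kd t wc wd x zc zd" and x0: "x 0 = 0"
    have wc1: "L_infinity_norm wc \<le> ereal 1" and wd1: "l_infinity_norm wd \<le> ereal 1"
      unfolding one_ereal_def[symmetric] w[symmetric] by simp_all
    note x = closed_loop(1)[OF cl]
    have "L_infinity_norm zc \<le> ereal \<gamma>"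
    proof (rule continuous_output_gain[OF t x x0 wc wc1 wd1 Ccl_cont timer_functions(6) _ nonneg(2) _
          closed_loop(2)[OF cl]])
      fix \<tau> assume \<tau>: "\<tau> \<in> {0..Tmax}"
      show "0 \<le> Ccl \<tau>"
        by (rule nonneg_of_mult_diagonal[OF X_diagonal[OF \<tau>] X_pos[OF \<tau>]])
          (simp add: CX[OF \<tau>] positivity(3)[OF \<tau>])
      show "Ccl \<tau> *v (X \<tau> *v 1) + F_c S \<tau> *v 1 \<le> \<gamma> *\<^sub>R 1"
        using performance(3)[OF \<tau>] by (simp add: matrix_vector_mul_assoc CX[OF \<tau>])
    qed
    moreover have "l_infinity_norm zd \<le> ereal \<gamma>"
    proof (rule discrete_output_gain[OF t x x0 wc1 wd1 _ nonneg(4) _ closed_loop(3)[OF cl]])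
      show "0 \<le> Cdcl"
        by (rule nonneg_of_mult_diagonal[OF M(1) M_pos]) (simp add: CM positivity(4))
      show "Cdcl *v (M *v 1) + F_d S *v 1 \<le> \<gamma> *\<^sub>R 1"
        using performance(4) by (simp add: matrix_vector_mul_assoc CM)
    qed
    ultimately show "max (L_infinity_norm zc) (l_infinity_norm zd) \<le> ereal \<gamma>"
      by simp
  qed
  ultimately show ?thesis ..
qed

end
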